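(* Let $X$ be a complex Banach space. (1) For every $\theta\in\mathbb{R}$, a non-empty set $\Gamma\subset\mathbb{C}$ satisfies the property "for every $T\in L(X)$ with $\sigma_p(T^* )=\{e^{i\theta}\}$ and every $x\in X$, $x$ is $\Gamma$-supercyclic for $T$ if and only if $x$ is supercyclic for $T$" if and only if $\Gamma G_\theta$ is dense in $\mathbb{C}$. (2) For any $r>0$ with $r\neq 1$ and any $\theta\in\mathbb{R}$, there exist $T\in L(X)$ with $\sigma_p(T^* )=\{re^{i\theta}\}$ and $\Gamma\subset\mathbb{C}$ satisfying $\overline{\Gamma G_\theta}=\mathbb{C}$, such that $T$ is supercyclic but not $\Gamma$-supercyclic.
   Context: For a complex Banach space $X$ (finite-dimensional spaces are also considered), $L(X)$ denotes the space of bounded linear operators on $X$; $T^*$ is the adjoint of $T\in L(X)$, acting on the dual $X^*$, and $\sigma_p(T^* )$ is its point spectrum (set of eigenvalues). For $T\in L(X)$, $x\in X$ and a non-empty set $\Gamma\subset\mathbb{C}$, put $\mathrm{Orb}(\Gamma x,T)=\{\gamma T^n x:\ \gamma\in\Gamma,\ n\ge 0\}$. The vector $x$ is $\Gamma$-supercyclic for $T$ if $\mathrm{Orb}(\Gamma x,T)$ is dense in $X$, and $T$ is $\Gamma$-supercyclic if it admits a $\Gamma$-supercyclic vector; "supercyclic" (for a vector or an operator) means $\mathbb{C}$-supercyclic. $G_\theta=\{e^{ik\theta}:k\in\mathbb{Z}\}$ is the subgroup of $\mathbb{T}=\{z\in\mathbb{C}:|z|=1\}$ generated by $e^{i\theta}$,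 and $\Gamma G_\theta=\{\gamma g:\gamma\in\Gamma,\ g\in G_\theta\}$.
   Formalization: "Only if" in (1) and part (2) are stated for separable X of dimension 1 or infinity (on other X no such T is supercyclic, so both fail), and (2) requires e^{iθ} ≠ 1 (otherwise Γ itself is dense and T is Γ-supercyclic); "if" in (1) holds for all X. *)

theory Defs
  imports "HOL-Analysis.Analysis"
begin

text \<open>
  Complex Banach spaces: real Banach spaces with a compatible complex scalar multiplication.
  Vector spaces, span and dimension over the complex numbers are those of
  \<^theory>\<open>HOL.Vector_Spaces\<close>.
\<close>

class complex_banach = banach +
  fixes scaleC :: "complex \<Rightarrow> 'a \<Rightarrow> 'a"  (infixr \<open>*\<^sub>C\<close> 75)
  assumes scaleC_add_right: "c *\<^sub>C (x + y) = c *\<^sub>C x + c *\<^sub>C y"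
    and scaleC_add_left: "(c + d) *\<^sub>C x = c *\<^sub>C x + d *\<^sub>C x"
    and scaleC_scaleC: "c *\<^sub>C (d *\<^sub>C x) = (c * d) *\<^sub>C x"
    and scaleC_of_real: "complex_of_real a *\<^sub>C x = a *\<^sub>R x"
    and norm_scaleC: "norm (c *\<^sub>C x) = cmod c * norm x"

instantiation complex :: complex_banach
begin

definition scaleC_complex :: "complex \<Rightarrow> complex \<Rightarrow> complex"
  where "scaleC_complex c z = c * z"

instance
  by standard (simp_all add: scaleC_complex_def algebra_simps norm_mult scaleR_conv_of_real)

end

global_interpretation complex_vector: vector_space "scaleC :: complex \<Rightarrow> 'a \<Rightarrow> 'a :: complex_banach"
  defines cspan_raw_def: cspan = complex_vector.span
    and cdim_raw_def: cdim = complex_vector.dim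
proof unfold_locales
  show "(1::complex) *\<^sub>C x = x" for x :: 'a
    using scaleC_of_real[of 1 x] by simp
qed (simp_all add: scaleC_add_right scaleC_add_left scaleC_scaleC)

hide_const (open)
  complex_vector.span
  complex_vector.dim

definition bounded_clinear :: "('a::complex_banach \<Rightarrow> 'b::complex_banach) \<Rightarrow> bool"
  where "bounded_clinear T \<longleftrightarrow> bounded_linear T \<and> (\<forall>c x. T (c *\<^sub>C x) = c *\<^sub>C T x)"

text \<open>
  The dual space is the set of bounded complex-linear functionals, on which the (Banach space)
  adjoint acts by precomposition, without any conjugation.
\<close>

definition dual_space :: "('a::complex_banach \<Rightarrow> complex) set"
  where "dual_space = {\<phi>. bounded_clinear \<phi>}"

definition adjoint_op :: "('a \<Rightarrow> 'a) \<Rightarrow> ('a \<Rightarrow> complex) \<Rightarrow> ('a \<Rightarrow> complex)"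
  where "adjoint_op T \<phi> = \<phi> \<circ> T"

definition adjoint_point_spectrum :: "('a::complex_banach \<Rightarrow> 'a) \<Rightarrow> complex set"
  where "adjoint_point_spectrum T =
    {\<mu>. \<exists>\<phi>\<in>dual_space. \<phi> \<noteq> (\<lambda>x. 0) \<and> adjoint_op T \<phi> = (\<lambda>x. \<mu> * \<phi> x)}"

definition scaled_orbit :: "complex set \<Rightarrow> 'a::complex_banach \<Rightarrow> ('a \<Rightarrow> 'a) \<Rightarrow> 'a set"
  where "scaled_orbit \<Gamma> x T = {\<gamma> *\<^sub>C (T ^^ n) x | \<gamma> n. \<gamma> \<in> \<Gamma>}"

definition supercyclic_vector :: "complex set \<Rightarrow> ('a::complex_banach \<Rightarrow> 'a) \<Rightarrow> 'a \<Rightarrow> bool"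
  where "supercyclic_vector \<Gamma> T x \<longleftrightarrow> closure (scaled_orbit \<Gamma> x T) = UNIV"

definition supercyclic_op :: "complex set \<Rightarrow> ('a::complex_banach \<Rightarrow> 'a) \<Rightarrow> bool"
  where "supercyclic_op \<Gamma> T \<longleftrightarrow> (\<exists>x. supercyclic_vector \<Gamma> T x)"

definition rotation_group :: "real \<Rightarrow> complex set"
  where "rotation_group \<theta> = {cis (of_int k * \<theta>) | k :: int. True}"

definition times_rotations :: "complex set \<Rightarrow> real \<Rightarrow> complex set"
  where "times_rotations \<Gamma> \<theta> = {\<gamma> * g | \<gamma> g. \<gamma> \<in> \<Gamma> \<and> g \<in> rotation_group \<theta>}"

definition supercyclicity_coincides :: "'a::complex_banach itself \<Rightarrow> real \<Rightarrow> complex set \<Rightarrow> bool"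
  where "supercyclicity_coincides X \<theta> \<Gamma> \<longleftrightarrow>
    (\<forall>(T :: 'a \<Rightarrow> 'a) x. bounded_clinear T \<and> adjoint_point_spectrum T = {cis \<theta>} \<longrightarrow>
      (supercyclic_vector \<Gamma> T x \<longleftrightarrow> supercyclic_vector UNIV T x))"

text \<open>
  The only complex Banach spaces on which an operator with non-empty adjoint point spectrum can be
  supercyclic are the separable ones that are one-dimensional or infinite-dimensional. On all others
  (for instance two-dimensional ones) there is no such operator.
\<close>

definition separable_dim_one_or_infinite :: "'a::complex_banach itself \<Rightarrow> bool"
  where "separable_dim_one_or_infinite X \<longleftrightarrow>
    separable_space (euclidean :: 'a topology) \<and>
    (cdim (UNIV :: 'a set) = 1 \<or> (\<nexists>B :: 'a set. finite B \<and> cspan B = UNIV))"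

text \<open>
  A dense \<open>\<Gamma>\<close> never separates the two notions. When \<open>e\<^bsup>i\<theta>\<^esup> = 1\<close> the rotation group is trivial, so
  density of \<open>\<Gamma> G\<^sub>\<theta>\<close> is density of \<open>\<Gamma>\<close>; an operator that is supercyclic but not
  \<open>\<Gamma>\<close>-supercyclic can therefore only be asked for when \<open>e\<^bsup>i\<theta>\<^esup> \<noteq> 1\<close>.
\<close>

lemma times_rotations_trivial:
  assumes "cis \<theta> = 1"
  shows "times_rotations \<Gamma> \<theta> = \<Gamma>"
proof -
  have "cis (of_int k * \<theta>) = 1" for k :: int
  proof -
    have "cis (of_int k * \<theta>) = cis \<theta> powi k"
      by (simp add: cis_power_int)
    then show ?thesis
      using assms by simp
  qed
  then show ?thesis
    by (auto simp: times_rotations_def rotation_group_def)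
qed

lemma supercyclic_op_of_dense:
  fixes T :: "'a::complex_banach \<Rightarrow> 'a"
  assumes dense: "closure \<Gamma> = UNIV" and super: "supercyclic_op UNIV T"
  shows "supercyclic_op \<Gamma> T"
proof -
  obtain x where x: "closure (scaled_orbit UNIV x T) = UNIV"
    using super by (auto simp: supercyclic_op_def supercyclic_vector_def)
  have "c *\<^sub>C (T ^^ n) x \<in> closure (scaled_orbit \<Gamma> x T)" for c n
  proof -
    have bl: "bounded_linear (\<lambda>c. c *\<^sub>C (T ^^ n) x)"
    proof (rule bounded_linear_intro[where K = "norm ((T ^^ n) x)"])
      show "(r *\<^sub>R a) *\<^sub>C (T ^^ n) x = r *\<^sub>R (a *\<^sub>C (T ^^ n) x)" for r a
        by (metis scaleC_of_real scaleC_scaleC scaleR_conv_of_real)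
    qed (simp_all add: scaleC_add_left norm_scaleC)
    have "(\<lambda>c. c *\<^sub>C (T ^^ n) x) ` closure \<Gamma> \<subseteq> closure ((\<lambda>c. c *\<^sub>C (T ^^ n) x) ` \<Gamma>)"
      by (rule closure_bounded_linear_image_subset[OF bl])
    also have "\<dots> \<subseteq> closure (scaled_orbit \<Gamma> x T)"
      by (rule closure_mono) (auto simp: scaled_orbit_def)
    finally show ?thesis
      using dense by auto
  qed
  then have "scaled_orbit UNIV x T \<subseteq> closure (scaled_orbit \<Gamma> x T)"
    by (auto simp: scaled_orbit_def)
  then have "closure (scaled_orbit \<Gamma> x T) = UNIV"
    using x by (metis closure_minimal closed_closure top.extremum_uniqueI)
  then show ?thesis
    by (auto simp: supercyclic_op_def supercyclic_vector_def)
qed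

end

theory Submission
  imports Defs "HOL-Computational_Algebra.Fundamental_Theorem_Algebra"
begin

text \<open>
  Sufficiency: let \<open>\<phi>\<close> be the eigenvector of the adjoint, normalised by \<open>\<phi> x = 1\<close>, and \<open>U = e\<^sup>-\<^sup>i\<^sup>\<theta> T\<close>. If \<open>x\<close> is
  supercyclic, its \<open>U\<close>-orbit is dense in the hyperplane \<open>\<phi> = 1\<close>, and everything follows once the pairs
  \<open>(e\<^sup>i\<^sup>n\<^sup>\<theta>, U\<^sup>n x)\<close> are dense in \<open>G\<^sub>\<theta> \<times> {\<phi> = 1}\<close>. Otherwise the limits of \<open>e\<^sup>i\<^sup>n\<^sup>\<theta>\<close> along return times
  of \<open>x\<close> form a closed subgroup of the circle not containing \<open>e\<^sup>i\<^sup>\<theta>\<close>, and one obtains a continuous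
  circle-valued eigenfunction of \<open>U\<close> with eigenvalue \<open>\<noteq> 1\<close> on the convex set \<open>{p(U) x. p(1) = 1}\<close>. This set is
  contractible, so the eigenfunction has a logarithm, which drifts linearly along the orbit of \<open>x\<close>,
  contradicting recurrence.

  Necessity and part (2) need an operator \<open>U\<close> fixing a functional \<open>\<phi>\<close> on a separable infinite-dimensional
  space. A biorthogonal sequence gives vectors \<open>v\<^sub>j\<close> and a bounded \<open>U\<close> acting on \<open>\<Sum> c\<^sub>j v\<^sub>j\<close> as the
  translation \<open>p(x) \<mapsto> p(x + 1)\<close> acts on the polynomial \<open>\<Sum> c\<^sub>j x\<^sup>j\<close>. As some polynomials
  of fixed degree are close to \<open>x\<^sup>j\<close> near \<open>0\<close> and to \<open>0\<close> near \<open>n\<close>, and vice versa, \<open>U\<close> is topologically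
  transitive up to scalars, and Baire's theorem applies. Applying \<open>\<phi>\<close> to orbits of \<open>\<lambda> U\<close> reduces the
  negative statements to non-density of \<open>{\<gamma> \<lambda>\<^sup>n}\<close> in the plane.
\<close>


subsection \<open>Complex Banach spaces\<close>

lemma scaleC_scaleR_left: "(r *\<^sub>R a) *\<^sub>C x = r *\<^sub>R (a *\<^sub>C x)"
  by (metis scaleC_of_real scaleC_scaleC scaleR_conv_of_real)

lemma scaleC_scaleR_right: "a *\<^sub>C (r *\<^sub>R x) = r *\<^sub>R (a *\<^sub>C x)"
  by (metis scaleC_of_real scaleC_scaleC mult.commute)

interpretation scaleC: bounded_bilinear "scaleC :: complex \<Rightarrow> 'a \<Rightarrow> 'a::complex_banach"
proof
  show "\<exists>K. \<forall>a (b::'a). norm (a *\<^sub>C b) \<le> norm a * norm b * K"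
    by (rule exI[of _ 1]) (simp add: norm_scaleC)
qed (simp_all add: scaleC_add_right scaleC_add_left scaleC_scaleR_left scaleC_scaleR_right)

lemma scaleC_one [simp]: "1 *\<^sub>C x = (x::'a::complex_banach)"
  by (rule complex_vector.scale_one)

lemma bounded_clinearI:
  assumes "\<And>x y. T (x + y) = T x + T y" "\<And>c x. T (c *\<^sub>C x) = c *\<^sub>C T x"
    and "\<And>x. norm (T x) \<le> norm x * K"
  shows "bounded_clinear T"
  unfolding bounded_clinear_def
proof (intro conjI allI bounded_linear_intro[of _ K])
  show "T (r *\<^sub>R x) = r *\<^sub>R T x" for r x
    by (metis assms(2) scaleC_of_real)
qed (use assms in auto)

lemma bounded_clinear_imp_bounded_linear: "bounded_clinear T \<Longrightarrow> bounded_linear T"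
  by (simp add: bounded_clinear_def)

lemma bounded_clinear_scaleC: "bounded_clinear T \<Longrightarrow> T (c *\<^sub>C x) = c *\<^sub>C T x"
  by (simp add: bounded_clinear_def)

lemma bounded_clinear_add: "bounded_clinear T \<Longrightarrow> T (x + y) = T x + T y"
  by (simp add: bounded_clinear_def linear_simps)

lemma bounded_clinear_diff: "bounded_clinear T \<Longrightarrow> T (x - y) = T x - T y"
  by (simp add: bounded_clinear_def linear_simps)

lemma bounded_clinear_zero: "bounded_clinear T \<Longrightarrow> T 0 = 0"
  by (simp add: bounded_clinear_def linear_simps)

lemma bounded_clinear_sum: "bounded_clinear T \<Longrightarrow> T (\<Sum>i\<in>A. g i) = (\<Sum>i\<in>A. T (g i))"
  by (simp add: bounded_clinear_def Real_Vector_Spaces.linear_sum bounded_linear.linear)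

lemmas bounded_clinear_simps = bounded_clinear_scaleC bounded_clinear_add bounded_clinear_diff
  bounded_clinear_zero

lemma bounded_clinear_continuous_on:
  "bounded_clinear T \<Longrightarrow> continuous_on S g \<Longrightarrow> continuous_on S (\<lambda>x. T (g x))"
  by (rule bounded_linear.continuous_on[OF bounded_clinear_imp_bounded_linear])

lemma bounded_clinear_tendsto:
  "bounded_clinear T \<Longrightarrow> (g \<longlongrightarrow> l) F \<Longrightarrow> ((\<lambda>x. T (g x)) \<longlongrightarrow> T l) F"
  by (rule bounded_linear.tendsto[OF bounded_clinear_imp_bounded_linear])

lemma bounded_clinear_ident: "bounded_clinear (\<lambda>x. x)"
  by (simp add: bounded_clinear_def)

lemma bounded_clinear_compose:
  "bounded_clinear S \<Longrightarrow> bounded_clinear T \<Longrightarrow> bounded_clinear (\<lambda>x. S (T x))"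
  by (auto simp: bounded_clinear_def intro: bounded_linear_compose)

lemma bounded_clinear_add_fun:
  "bounded_clinear S \<Longrightarrow> bounded_clinear T \<Longrightarrow> bounded_clinear (\<lambda>x. S x + T x)"
  by (auto simp: bounded_clinear_def scaleC_add_right intro: bounded_linear_add)

lemma bounded_clinear_diff_fun:
  "bounded_clinear S \<Longrightarrow> bounded_clinear T \<Longrightarrow> bounded_clinear (\<lambda>x. S x - T x)"
  by (auto simp: bounded_clinear_def scaleC.diff_right intro: bounded_linear_sub)

lemma bounded_clinear_scaleC_fun:
  "bounded_clinear T \<Longrightarrow> bounded_clinear (\<lambda>x. c *\<^sub>C T x)"
  by (auto simp: bounded_clinear_def scaleC_scaleC mult.commute
      intro: scaleC.bounded_linear_right[THEN bounded_linear_compose])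

lemma bounded_clinear_funpow:
  fixes T :: "'a::complex_banach \<Rightarrow> 'a"
  shows "bounded_clinear T \<Longrightarrow> bounded_clinear (T ^^ n)"
proof (induction n)
  case 0
  have "T ^^ 0 = (\<lambda>x. x)" by (rule ext) simp
  then show ?case by (simp only: bounded_clinear_ident)
next
  case (Suc n)
  have "T ^^ Suc n = (\<lambda>x. T ((T ^^ n) x))" by (rule ext) simp
  then show ?case using bounded_clinear_compose[of T "T ^^ n"] Suc by (simp only:)
qed

lemma bounded_clinear_functional_scaleC:
  "bounded_clinear f \<Longrightarrow> bounded_clinear (\<lambda>x. f x *\<^sub>C e)"
  by (auto simp: bounded_clinear_def scaleC_scaleC scaleC_complex_def
      intro: scaleC.bounded_linear_left[THEN bounded_linear_compose])

lemma bounded_clinear_times: "bounded_clinear T \<Longrightarrow> T (c *\<^sub>C x) = c * T x"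
  by (simp add: bounded_clinear_def scaleC_complex_def)

lemma bounded_clinear_mult_const:
  "bounded_clinear f \<Longrightarrow> bounded_clinear (\<lambda>x. c * f x :: complex)"
  using bounded_clinear_scaleC_fun[of f c] by (simp add: scaleC_complex_def)

lemma bounded_clinear_eq_on_dense_span:
  assumes f: "bounded_clinear f" and S: "closure (cspan S) = UNIV" and 0: "\<And>x. x \<in> S \<Longrightarrow> f x = 0"
  shows "f x = 0"
proof -
  have span: "f y = 0" if "y \<in> cspan S" for y
    using that
    by (induction rule: complex_vector.span_induct_alt)
      (auto simp: bounded_clinear_simps[OF f] 0 scaleC.zero_right)
  have "closed {x. f x = 0}"
    by (intro closed_Collect_eq continuous_on_const bounded_clinear_continuous_on[OF f])
      (rule continuous_on_id)
  then have "closure (cspan S) \<subseteq> {x. f x = 0}"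
    using span by (intro closure_minimal) auto
  then show ?thesis using S by auto
qed

subsection \<open>The Hahn--Banach theorem\<close>

definition sublinear :: "('a::real_vector \<Rightarrow> real) \<Rightarrow> bool"
  where "sublinear q \<longleftrightarrow> (\<forall>x y. q (x + y) \<le> q x + q y) \<and> (\<forall>t x. t \<ge> 0 \<longrightarrow> q (t *\<^sub>R x) = t * q x)"

lemma sublinear_add: "sublinear q \<Longrightarrow> q (x + y) \<le> q x + q y"
  by (simp add: sublinear_def)

lemma sublinear_scaleR: "sublinear q \<Longrightarrow> t \<ge> 0 \<Longrightarrow> q (t *\<^sub>R x) = t * q x"
  by (simp add: sublinear_def)

lemma sublinear_zero: "sublinear q \<Longrightarrow> q 0 = 0"
  using sublinear_scaleR[of q 0 0] by simp

lemma sublinear_minus: "sublinear q \<Longrightarrow> - q (- x) \<le> q x"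
  using sublinear_add[of q x "- x"] sublinear_zero[of q] by simp

text \<open>Only one inequality of homogeneity has to be checked: applied to \<open>1/t\<close> and
  \<open>t *\<^sub>R x\<close> it yields the reverse one.\<close>

lemma sublinearI:
  assumes add: "\<And>x y. q (x + y) \<le> q x + q y" and "q 0 = 0"
    and le: "\<And>t x. t > 0 \<Longrightarrow> q (t *\<^sub>R x) \<le> t * q x"
  shows "sublinear q"
proof -
  have "q (t *\<^sub>R x) = t * q x" if "t \<ge> 0" for t x
  proof (cases "t = 0")
    case True then show ?thesis using assms(2) by simp
  next
    case False
    then have t: "t > 0" using that by simp
    have "q ((1/t) *\<^sub>R (t *\<^sub>R x)) \<le> (1/t) * q (t *\<^sub>R x)"
      by (rule le) (use t in simp)
    then have "t * q x \<le> q (t *\<^sub>R x)" using t by (simp add: field_simps)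
    then show ?thesis using le[OF t, of x] by linarith
  qed
  then show ?thesis using add by (simp add: sublinear_def)
qed

text \<open>The tilt of \<open>q\<close> in direction \<open>y\<close> is the infimum of
  \<open>q (x + t *\<^sub>R y) - t * q y\<close> over \<open>t \<ge> 0\<close>; the values
  \<open>t = 0\<close> and \<open>t = 1\<close> give the two upper bounds.\<close>

lemma sublinear_tilt:
  assumes q: "sublinear q"
  obtains r where "sublinear r" "\<And>x. r x \<le> q x" "\<And>x. r x \<le> q (x + y) - q y"
proof
  define h where "h x t = q (x + t *\<^sub>R y) - t * q y" for x t
  define r where "r x = (INF t\<in>{0..}. h x t)" for x
  \<comment> \<open>Subadditivity for \<open>t *\<^sub>R y = (x + t *\<^sub>R y) + (- x)\<close>
    bounds the family from below, so the infimum is finite.\<close>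
  have lower: "- q (- x) \<le> h x t" if "t \<ge> 0" for x t
    using sublinear_add[OF q, of "x + t *\<^sub>R y" "- x"] sublinear_scaleR[OF q that, of y]
    by (simp add: h_def)
  have bdd: "bdd_below (h x ` {0..})" for x
    by (rule bdd_belowI2[of _ "- q (- x)"]) (use lower in auto)
  have le: "r x \<le> h x t" if "t \<ge> 0" for x t
    unfolding r_def by (rule cINF_lower[OF bdd]) (use that in simp)
  have ge: "c \<le> r x" if "\<And>t. t \<ge> 0 \<Longrightarrow> c \<le> h x t" for x c
    unfolding r_def by (rule cINF_greatest) (use that in auto)
  show "r x \<le> q x" for x using le[of 0 x] by (simp add: h_def)
  show "r x \<le> q (x + y) - q y" for x using le[of 1 x] by (simp add: h_def)
  show "sublinear r"
  proof (rule sublinearI)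
    fix x x'
    have *: "r (x + x') \<le> h x s + h x' t" if "s \<ge> 0" "t \<ge> 0" for s t
    proof -
      have "r (x + x') \<le> h (x + x') (s + t)" using that by (intro le) simp
      also have "\<dots> \<le> h x s + h x' t"
        using sublinear_add[OF q, of "x + s *\<^sub>R y" "x' + t *\<^sub>R y"]
        by (simp add: h_def algebra_simps)
      finally show ?thesis .
    qed
    have "r (x + x') - h x s \<le> r x'" if "s \<ge> 0" for s
      by (rule ge) (use *[OF that] in \<open>simp add: algebra_simps\<close>)
    then have "r (x + x') - r x' \<le> r x"
      by (intro ge) (simp add: algebra_simps)
    then show "r (x + x') \<le> r x + r x'" by simp
  next
    have "h 0 t = 0" if "t \<ge> 0" for t using sublinear_scaleR[OF q that, of y] by (simp add: h_def)
    then show "r 0 = 0" using le[of 0 0] ge[of 0 0] by force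
  next
    fix t :: real and x assume t: "t > 0"
    have "r (t *\<^sub>R x) / t \<le> h x s" if "s \<ge> 0" for s
    proof -
      have "r (t *\<^sub>R x) \<le> h (t *\<^sub>R x) (t * s)" using t that by (intro le) simp
      also have "\<dots> = t * h x s"
        using sublinear_scaleR[OF q, of t "x + s *\<^sub>R y"] t by (simp add: h_def algebra_simps)
      finally show ?thesis using t by (simp add: field_simps)
    qed
    then have "r (t *\<^sub>R x) / t \<le> r x" by (rule ge)
    then show "r (t *\<^sub>R x) \<le> t * r x" using t by (simp add: field_simps)
  qed
qed

text \<open>This bounds chains for Zorn's lemma. The common majorant \<open>p\<close> forces
  \<open>- p (- x) \<le> q x\<close>, so the pointwise infimum is finite; it is subadditive because
  the smaller of two members of the chain can serve for both summands.\<close>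

lemma sublinear_Inf_chain:
  assumes "C \<noteq> {}" and C: "\<And>q. q \<in> C \<Longrightarrow> sublinear q \<and> (\<forall>x. q x \<le> p x)"
    and chain: "\<And>q r. q \<in> C \<Longrightarrow> r \<in> C \<Longrightarrow> (\<forall>x. q x \<le> r x) \<or> (\<forall>x. r x \<le> q x)"
  obtains u where "sublinear u" "\<And>q x. q \<in> C \<Longrightarrow> u x \<le> q x"
proof
  define u where "u x = (INF q\<in>C. q x)" for x
  have "- p (- x) \<le> q x" if "q \<in> C" for q x
    using sublinear_minus[of q x] C[OF that] by (meson le_imp_neg_le order_trans)
  then have bdd: "bdd_below ((\<lambda>q. q x) ` C)" for x
    by (intro bdd_belowI2)
  show le: "u x \<le> q x" if "q \<in> C" for q x
    unfolding u_def by (rule cINF_lower[OF bdd that])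
  have ge: "c \<le> u x" if "\<And>q. q \<in> C \<Longrightarrow> c \<le> q x" for x c
    unfolding u_def using assms(1) that by (rule cINF_greatest)
  show "sublinear u"
  proof (rule sublinearI)
    fix x y
    have *: "u (x + y) \<le> q x + r y" if qr: "q \<in> C" "r \<in> C" for q r
      using chain[OF qr]
    proof
      assume "\<forall>x. q x \<le> r x"
      then have "q y \<le> r y" by blast
      then show ?thesis
        using le[OF qr(1), of "x + y"] sublinear_add[OF conjunct1[OF C[OF qr(1)]], of x y]
        by linarith
    next
      assume "\<forall>x. r x \<le> q x"
      then have "r x \<le> q x" by blast
      then show ?thesis
        using le[OF qr(2), of "x + y"] sublinear_add[OF conjunct1[OF C[OF qr(2)]], of x y]
        by linarith
    qed
    have "u (x + y) - q x \<le> u y" if "q \<in> C" for q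
      by (rule ge) (use *[OF that] in \<open>simp add: algebra_simps\<close>)
    then have "u (x + y) - u y \<le> u x"
      by (intro ge) (simp add: algebra_simps)
    then show "u (x + y) \<le> u x + u y" by simp
  next
    have "u 0 \<le> 0" using le[of _ 0] assms(1) sublinear_zero C by (metis all_not_in_conv)
    moreover have "0 \<le> u 0" using C sublinear_zero by (intro ge) force
    ultimately show "u 0 = 0" by simp
  next
    fix t :: real and x assume t: "t > 0"
    have "u (t *\<^sub>R x) / t \<le> q x" if "q \<in> C" for q
      using le[OF that, of "t *\<^sub>R x"] sublinear_scaleR[of q t x] C[OF that] t
      by (simp add: field_simps)
    then have "u (t *\<^sub>R x) / t \<le> u x" by (rule ge)
    then show "u (t *\<^sub>R x) \<le> t * u x" using t by (simp add: field_simps)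
  qed
qed

text \<open>A pointwise minimal sublinear functional coincides with all of its tilts, hence is additive.\<close>

lemma sublinear_dominates_linear:
  assumes p: "sublinear p"
  obtains f where "linear f" "\<And>x. f x \<le> p x"
proof -
  define A where "A = {q. sublinear q \<and> (\<forall>x. q x \<le> p x)}"
  \<comment> \<open>The pointwise order is reversed, so that a maximal element in the sense of Zorn
    is a minimal sublinear functional.\<close>
  define P where "P q r \<longleftrightarrow> (\<forall>x. r x \<le> q x)" for q r :: "'a \<Rightarrow> real"
  have "\<exists>m\<in>A. \<forall>a\<in>A. P m a \<longrightarrow> a = m"
  proof (rule predicate_Zorn)
    show "partial_order_on A (relation_of P A)"
    proof -
      have "P q q" "P q r \<Longrightarrow> P r s \<Longrightarrow> P q s" for q r s
        unfolding P_def by (auto intro: order_trans)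
      moreover have "P q r \<Longrightarrow> P r q \<Longrightarrow> q = r" for q r
        unfolding P_def by (rule ext) (meson order_antisym)
      ultimately show ?thesis
        unfolding partial_order_on_def preorder_on_def refl_on_def trans_def antisym_def relation_of_def
        by blast
    qed
  next
    fix C assume C: "C \<in> Chains (relation_of P A)"
    show "\<exists>u\<in>A. \<forall>a\<in>C. P a u"
    proof (cases "C = {}")
      case True
      then show ?thesis using p by (auto simp: A_def)
    next
      case False
      have CA: "sublinear q \<and> (\<forall>x. q x \<le> p x)" if "q \<in> C" for q
        using C that by (auto simp: Chains_def relation_of_def A_def)
      have "(\<forall>x. q x \<le> r x) \<or> (\<forall>x. r x \<le> q x)" if "q \<in> C" "r \<in> C" for q r
        using C that by (auto simp: Chains_def relation_of_def P_def)
      then obtain u where u: "sublinear u" "\<And>q x. q \<in> C \<Longrightarrow> u x \<le> q x"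
        using sublinear_Inf_chain[OF False, of p] CA by blast
      have "u x \<le> p x" for x using u(2) CA False by (meson all_not_in_conv order_trans)
      then show ?thesis using u by (auto simp: A_def P_def)
    qed
  qed
  then obtain q where q: "sublinear q" "\<And>x. q x \<le> p x"
    and min: "\<And>r. sublinear r \<Longrightarrow> (\<And>x. r x \<le> q x) \<Longrightarrow> r = q"
  proof -
    assume "\<exists>m\<in>A. \<forall>a\<in>A. P m a \<longrightarrow> a = m"
    then obtain q where q: "q \<in> A" and min: "\<And>r. r \<in> A \<Longrightarrow> P q r \<Longrightarrow> r = q" by blast
    show thesis
    proof (rule that)
      show "sublinear q" "\<And>x. q x \<le> p x" using q by (auto simp: A_def)
      show "r = q" if "sublinear r" "\<And>x. r x \<le> q x" for r
        using that q by (intro min) (auto simp: A_def P_def intro: order_trans)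
    qed
  qed
  have add: "q (x + y) = q x + q y" for x y
  proof -
    obtain r where "sublinear r" "\<And>x. r x \<le> q x" "\<And>x. r x \<le> q (x + y) - q y"
      using sublinear_tilt[OF q(1), of y] by blast
    then have "q x \<le> q (x + y) - q y" using min by metis
    then show ?thesis using sublinear_add[OF q(1), of x y] by simp
  qed
  have neg: "q (- x) = - q x" for x
    using add[of x "- x"] sublinear_zero[OF q(1)] by simp
  have "q (t *\<^sub>R x) = t * q x" for t x
  proof (cases "t \<ge> 0")
    case False
    then have "q ((- t) *\<^sub>R x) = - t * q x" by (intro sublinear_scaleR q) simp
    then show ?thesis using neg[of "t *\<^sub>R x"] by simp
  qed (simp add: sublinear_scaleR q)
  then have "linear q" by (intro linearI) (simp_all add: add)
  then show thesis using q(2) that by blast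
qed

text \<open>The value at \<open>a\<close> is prescribed by tilting first: the tilt \<open>r\<close>
  satisfies \<open>r (- a) \<le> - p a\<close>, hence any linear functional below \<open>r\<close>
  takes at least the value \<open>p a\<close> at \<open>a\<close>.\<close>

lemma Hahn_Banach_sublinear:
  assumes p: "sublinear p"
  obtains f where "linear f" "\<And>x. f x \<le> p x" "f a = p a"
proof -
  obtain r where r: "sublinear r" "\<And>x. r x \<le> p x" "\<And>x. r x \<le> p (x + a) - p a"
    using sublinear_tilt[OF p, of a] by blast
  obtain f where f: "linear f" "\<And>x. f x \<le> r x" using sublinear_dominates_linear[OF r(1)] by blast
  have "f (- a) \<le> - p a" using f(2)[of "- a"] r(3)[of "- a"] sublinear_zero[OF p] by simp
  then have "f a = p a" using f(2)[of a] r(2)[of a] linear_neg[OF f(1), of a] by linarith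
  then show thesis using that f r(2) by (meson order_trans)
qed

text \<open>The distance to \<open>M\<close> is the quotient seminorm. A linear functional below it
  vanishes on \<open>M\<close> and is bounded by the norm.\<close>

lemma sublinear_infdist:
  fixes M :: "'a::complex_banach set"
  assumes M: "complex_vector.subspace M"
  shows "sublinear (\<lambda>x. infdist x M)"
proof (rule sublinearI)
  have ne: "M \<noteq> {}" using complex_vector.subspace_0[OF M] by auto
  have approx: "\<exists>m\<in>M. dist x m < infdist x M + e" if "e > 0" for x :: 'a and e
  proof -
    have "(INF a\<in>M. dist x a) < infdist x M + e" using that ne by (simp add: infdist_def)
    then show ?thesis using ne by (subst (asm) cINF_less_iff) auto
  qed
  show "infdist (x + y) M \<le> infdist x M + infdist y M" for x y
  proof (rule field_le_epsilon)
    fix e :: real assume e: "e > 0"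
    obtain a where a: "a \<in> M" "dist x a < infdist x M + e/2" using approx[of "e/2"] e by auto
    obtain b where b: "b \<in> M" "dist y b < infdist y M + e/2" using approx[of "e/2"] e by auto
    have "infdist (x + y) M \<le> dist (x + y) (a + b)"
      by (intro infdist_le complex_vector.subspace_add[OF M] a b)
    also have "\<dots> \<le> dist x a + dist y b" by (rule dist_triangle_add)
    finally show "infdist (x + y) M \<le> infdist x M + infdist y M + e" using a b by simp
  qed
  show "infdist 0 M = 0" using complex_vector.subspace_0[OF M] by simp
  show "infdist (t *\<^sub>R x) M \<le> t * infdist x M" if t: "t > 0" for t x
  proof (rule field_le_epsilon)
    fix e :: real assume e: "e > 0"
    obtain a where a: "a \<in> M" "dist x a < infdist x M + e/t" using approx[of "e/t"] e t by auto
    have "t *\<^sub>R a \<in> M"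
      using complex_vector.subspace_scale[OF M a(1), of "of_real t"] by (simp add: scaleC_of_real)
    then have "infdist (t *\<^sub>R x) M \<le> dist (t *\<^sub>R x) (t *\<^sub>R a)" by (rule infdist_le)
    also have "\<dots> = t * dist x a"
      using t by (simp add: dist_norm flip: scaleR_diff_right)
    also have "\<dots> \<le> t * infdist x M + e" using a t by (simp add: field_simps)
    finally show "infdist (t *\<^sub>R x) M \<le> t * infdist x M + e" .
  qed
qed

theorem Hahn_Banach_separation:
  fixes M :: "'a::complex_banach set"
  assumes M: "complex_vector.subspace M" and cl: "closed M" and a: "a \<notin> M"
  obtains \<phi> where "\<phi> \<in> dual_space" "\<And>x. x \<in> M \<Longrightarrow> \<phi> x = 0" "\<phi> a = 1"
proof -
  have M0: "0 \<in> M" using complex_vector.subspace_0[OF M] .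
  obtain f where f: "linear f" "\<And>x. f x \<le> infdist x M" "f a = infdist a M"
    using Hahn_Banach_sublinear[OF sublinear_infdist[OF M], of a] by blast
  have fa: "f a > 0"
    using f(3) a cl M0 infdist_pos_not_in_closed[of M a] by auto
  have fM: "f x = 0" if "x \<in> M" for x
    using f(2)[of x] f(2)[of "- x"] that complex_vector.subspace_neg[OF M that]
    by (simp add: linear_neg[OF f(1)])
  have fb: "\<bar>f x\<bar> \<le> norm x" for x
    using f(2)[of x] f(2)[of "- x"] infdist_le[OF M0, of x] infdist_le[OF M0, of "- x"]
    by (simp add: linear_neg[OF f(1)])
  \<comment> \<open>This is the complex-linear functional with real part \<open>f\<close>; dividing
    it by \<open>g a\<close> gives the required \<open>\<phi>\<close>.\<close>
  define g where "g x = Complex (f x) (- f (\<i> *\<^sub>C x))" for x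
  have ii: "\<i> *\<^sub>C \<i> *\<^sub>C x = - x" for x :: 'a
    by (simp add: scaleC_scaleC scaleC.minus_left)
  have gi: "g (\<i> *\<^sub>C x) = \<i> * g x" for x
    by (simp add: g_def complex_eq_iff ii linear_neg[OF f(1)])
  have gadd: "g (x + y) = g x + g y" for x y
    by (simp add: g_def complex_eq_iff scaleC_add_right linear_add[OF f(1)])
  have gr: "g (r *\<^sub>R x) = of_real r * g x" for x r
    by (simp add: g_def complex_eq_iff scaleC_scaleR_right linear_scale[OF f(1)])
  have gc: "g (c *\<^sub>C x) = c * g x" for c x
  proof -
    have "c *\<^sub>C x = Re c *\<^sub>R x + \<i> *\<^sub>C (Im c *\<^sub>R x)"
      by (metis complex_eq scaleC_add_left scaleC_of_real scaleC_scaleC)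
    then have "g (c *\<^sub>C x) = (of_real (Re c) + \<i> * of_real (Im c)) * g x"
      by (simp only: gadd gi gr) (simp add: algebra_simps)
    then show ?thesis by (simp add: complex_eq[symmetric])
  qed
  have gb: "norm (g x) \<le> norm x * 2" for x
    using cmod_le[of "g x"] fb[of x] fb[of "\<i> *\<^sub>C x"] by (simp add: g_def norm_scaleC)
  have "bounded_clinear g"
    by (rule bounded_clinearI[OF gadd _ gb]) (simp add: gc scaleC_complex_def)
  then have bg: "bounded_clinear (\<lambda>x. (1 / g a) * g x)"
    by (rule bounded_clinear_mult_const)
  have "g a \<noteq> 0" using fa by (simp add: g_def complex_eq_iff)
  moreover have "g x = 0" if "x \<in> M" for x
    using fM[OF that] fM[OF complex_vector.subspace_scale[OF M that, of \<i>]]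
    by (simp add: g_def complex_eq_iff)
  ultimately show thesis
    using that[of "\<lambda>x. (1 / g a) * g x"] bg by (simp add: dual_space_def)
qed

lemma Hahn_Banach_nonzero:
  fixes a :: "'a::complex_banach"
  assumes "a \<noteq> 0"
  obtains \<phi> where "\<phi> \<in> dual_space" "\<phi> a = 1"
  using Hahn_Banach_separation[of "{0}" a] assms complex_vector.subspace_single_0 by auto

subsection \<open>Linear combinations with polynomial coefficients\<close>

text \<open>This has two uses: with \<open>v i = (U ^^ i) y\<close> it is the polynomial calculus
  \<open>p(U) y\<close>, and with the vectors of \<open>translation_operator\<close> it transports
  translation of polynomials to the space.\<close>

definition poly_comb :: "(nat \<Rightarrow> 'a::complex_banach) \<Rightarrow> complex poly \<Rightarrow> 'a"
  where "poly_comb v p = (\<Sum>i\<le>degree p. coeff p i *\<^sub>C v i)"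

lemma poly_comb_eq_sum:
  assumes "degree p \<le> n"
  shows "poly_comb v p = (\<Sum>i\<le>n. coeff p i *\<^sub>C v i)"
  unfolding poly_comb_def using assms
  by (intro sum.mono_neutral_left) (auto simp: coeff_eq_0 scaleC.zero_left not_le)

lemma poly_comb_add: "poly_comb v (p + q) = poly_comb v p + poly_comb v q"
proof -
  define n where "n = max (degree p) (degree q)"
  have n: "degree p \<le> n" "degree q \<le> n" "degree (p + q) \<le> n"
    by (auto simp: n_def intro: degree_add_le)
  show ?thesis
    by (simp add: poly_comb_eq_sum[OF n(1)] poly_comb_eq_sum[OF n(2)] poly_comb_eq_sum[OF n(3)]
        scaleC_add_left sum.distrib)
qed

lemma poly_comb_smult: "poly_comb v (smult c p) = c *\<^sub>C poly_comb v p"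
  by (simp add: poly_comb_eq_sum[OF degree_smult_le] poly_comb_def scaleC.sum_right scaleC_scaleC)

lemma poly_comb_0 [simp]: "poly_comb v 0 = 0"
  by (simp add: poly_comb_def scaleC.zero_left)

lemma poly_comb_sum: "poly_comb v (\<Sum>i\<in>A. p i) = (\<Sum>i\<in>A. poly_comb v (p i))"
  by (induction A rule: infinite_finite_induct) (auto simp: poly_comb_add)

lemma poly_comb_pCons: "poly_comb v (pCons a p) = a *\<^sub>C v 0 + poly_comb (\<lambda>i. v (Suc i)) p"
proof -
  have "poly_comb v (pCons a p) = (\<Sum>i\<le>Suc (degree p). coeff (pCons a p) i *\<^sub>C v i)"
    by (rule poly_comb_eq_sum) (rule degree_pCons_le)
  also have "\<dots> = a *\<^sub>C v 0 + (\<Sum>i\<le>degree p. coeff p i *\<^sub>C v (Suc i))"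
    by (subst sum.atMost_Suc_shift) simp
  finally show ?thesis by (simp add: poly_comb_def)
qed

lemma poly_comb_monom: "poly_comb v (monom c n) = c *\<^sub>C v n"
proof -
  have "poly_comb v (monom c n) = (\<Sum>i\<le>n. coeff (monom c n) i *\<^sub>C v i)"
    by (rule poly_comb_eq_sum) (rule degree_monom_le)
  also have "\<dots> = (\<Sum>i\<le>n. if i = n then c *\<^sub>C v n else 0)"
    by (intro sum.cong) (auto simp: scaleC.zero_left)
  finally show ?thesis by simp
qed

lemma bounded_clinear_poly_comb:
  "bounded_clinear T \<Longrightarrow> T (poly_comb v p) = poly_comb (\<lambda>i. T (v i)) p"
  by (simp add: poly_comb_def bounded_clinear_sum bounded_clinear_scaleC)

text \<open>The uniform degree bound \<open>K\<close> turns the combinations into sums of fixed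
  length, so coefficientwise convergence suffices.\<close>

lemma poly_comb_tendsto:
  assumes deg: "\<And>n. degree (P n) \<le> K" "degree Q \<le> K"
    and lim: "\<And>i. (\<lambda>n. coeff (P n) i) \<longlonglongrightarrow> coeff Q i"
  shows "(\<lambda>n. poly_comb v (P n)) \<longlonglongrightarrow> poly_comb v Q"
  unfolding poly_comb_eq_sum[OF deg(1)] poly_comb_eq_sum[OF deg(2)]
  by (intro tendsto_sum scaleC.tendsto lim tendsto_const)

subsection \<open>Closed subsemigroups of the circle\<close>

text \<open>By compactness some powers of \<open>a\<close> converge along a subsequence. Quotients
  of consecutive terms are then positive powers of \<open>a\<close> tending to 1, and dividing these
  once more by \<open>a\<close> gives the inverse.\<close>

lemma circle_closed_semigroup_group:
  fixes H :: "complex set"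
  assumes "closed H" "H \<subseteq> sphere 0 1" "H \<noteq> {}" and mult: "\<And>a b. a \<in> H \<Longrightarrow> b \<in> H \<Longrightarrow> a * b \<in> H"
  shows "1 \<in> H" "\<And>a. a \<in> H \<Longrightarrow> inverse a \<in> H"
proof -
  have pow: "a ^ Suc n \<in> H" if "a \<in> H" for a n
    by (induction n) (use that mult in auto)
  have key: "1 \<in> H \<and> (1 \<in> H \<longrightarrow> inverse a \<in> H)" if a: "a \<in> H" for a
  proof -
    have a1: "norm a = 1" using a assms(2) by auto
    then have a0: "a \<noteq> 0" by auto
    have "\<forall>n. a ^ n \<in> sphere 0 1" using a1 by (simp add: norm_power)
    then obtain b r where b: "b \<in> sphere 0 1" and r: "strict_mono r"
      and lim: "((\<lambda>n. a ^ n) \<circ> r) \<longlonglongrightarrow> b"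
      using compact_sphere[of "0::complex" 1] unfolding compact_def by metis
    have lt: "r k < r (Suc k)" for k using r by (simp add: strict_mono_Suc_iff)
    \<comment> \<open>Subtracting 1 keeps the exponent \<open>Suc (d k)\<close> positive, so these
      powers lie in \<open>H\<close> before \<open>1 \<in> H\<close> is known; \<open>d k\<close> is
      the exponent left after dividing by \<open>a\<close>.\<close>
    define d where "d k = r (Suc k) - r k - 1" for k
    have "(\<lambda>k. a ^ r (Suc k) / a ^ r k) \<longlonglongrightarrow> b / b"
      using lim b LIMSEQ_Suc[OF lim] by (intro tendsto_divide) (auto simp: o_def)
    moreover have "a ^ r (Suc k) / a ^ r k = a ^ Suc (d k)" for k
    proof -
      have "r (Suc k) = Suc (d k) + r k" using lt[of k] by (simp add: d_def)
      then show ?thesis using a0 by (simp add: power_add)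
    qed
    moreover have "b / b = 1" using b by auto
    ultimately have 1: "(\<lambda>k. a ^ Suc (d k)) \<longlonglongrightarrow> 1" by (simp only:)
    then have one: "1 \<in> H"
      using closed_sequentially[OF assms(1), of "\<lambda>k. a ^ Suc (d k)"] pow[OF a] by blast
    have "(\<lambda>k. a ^ Suc (d k) / a) \<longlonglongrightarrow> 1 / a"
      by (intro tendsto_divide 1 tendsto_const a0)
    moreover have "a ^ Suc (d k) / a = a ^ d k" for k using a0 by simp
    ultimately have "(\<lambda>k. a ^ d k) \<longlonglongrightarrow> inverse a" by (simp only: inverse_eq_divide)
    moreover have "a ^ n \<in> H" for n
      using one pow[OF a] by (cases n) auto
    ultimately show ?thesis
      using one closed_sequentially[OF assms(1), of "\<lambda>k. a ^ d k"] by blast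
  qed
  show "1 \<in> H" using key assms(3) by blast
  then show "inverse a \<in> H" if "a \<in> H" for a using key[OF that] by blast
qed

text \<open>The powers of \<open>\<rho>\<close> run around the circle in steps of its angle
  \<open>t\<close>, so rounding the quotient of the angles down leaves an error of at most one step.
  Chord length increases with the angle on \<open>[0, pi]\<close>.\<close>

lemma circle_powi_near:
  fixes \<rho> w :: complex
  assumes \<rho>: "norm \<rho> = 1" "\<rho> \<noteq> 1" and w: "norm w = 1"
  obtains k :: int where "norm (w - \<rho> powi k) \<le> norm (\<rho> - 1)"
proof -
  define t where "t = Arg \<rho>"
  have \<rho>t: "\<rho> = cis t" 
    using \<rho>(1) rcis_cmod_Arg[of \<rho>] by (simp add: rcis_def t_def)
  have "t \<noteq> 0"
  proof
    assume "t = 0"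
    then show False using \<rho>(2) \<rho>t by (metis cis_zero)
  qed
  moreover have "\<bar>t\<bar> \<le> pi"
    using Arg_bounded[of \<rho>] by (simp add: t_def abs_le_iff)
  ultimately have t: "\<bar>t\<bar> \<le> pi" "t \<noteq> 0" by auto
  have chord: "norm (cis a - 1) ^ 2 = 2 - 2 * cos a" for a
  proof -
    have "norm (cis a - 1) ^ 2 = (cos a - 1) ^ 2 + sin a ^ 2"
      by (simp add: cmod_power2)
    also have "\<dots> = 2 - 2 * cos a"
      using sin_cos_squared_add[of a] by (simp add: power2_eq_square algebra_simps)
    finally show ?thesis .
  qed
  define s where "s = Arg w"
  have ws: "w = cis s" 
    using w rcis_cmod_Arg[of w] by (simp add: rcis_def s_def)
  define k where "k = \<lfloor>s / t\<rfloor>"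
  have "0 \<le> s / t - k" "s / t - k \<le> 1" unfolding k_def by linarith+
  then have "\<bar>(s / t - k) * t\<bar> \<le> 1 * \<bar>t\<bar>" unfolding abs_mult by (intro mult_right_mono) auto
  then have st: "\<bar>s - k * t\<bar> \<le> \<bar>t\<bar>" using t(2) by (simp add: left_diff_distrib)
  have "cos t \<le> cos (s - k * t)"
    using cos_monotone_0_pi_le[of "\<bar>s - k * t\<bar>" "\<bar>t\<bar>"] st t by simp
  then have "norm (cis (s - k * t) - 1) ^ 2 \<le> norm (cis t - 1) ^ 2" by (simp add: chord)
  then have le: "norm (cis (s - k * t) - 1) \<le> norm (cis t - 1)"
    by (rule power2_le_imp_le) simp
  have "cis s - cis (k * t) = cis (k * t) * (cis (s - k * t) - 1)"
    by (simp add: right_diff_distrib cis_mult)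
  then have "norm (w - \<rho> powi k) = norm (cis (s - k * t) - 1)"
    by (simp add: ws \<rho>t cis_power_int norm_mult)
  then show thesis using le that \<rho>t by metis
qed

text \<open>An infinite subset of the circle accumulates somewhere. Quotients of two nearby elements
  are close to, but different from, 1, and their powers form an arbitrarily fine mesh.\<close>

lemma circle_infinite_closed_semigroup:
  fixes H :: "complex set"
  assumes cl: "closed H" and sub: "H \<subseteq> sphere 0 1" and inf: "infinite H"
    and mult: "\<And>a b. a \<in> H \<Longrightarrow> b \<in> H \<Longrightarrow> a * b \<in> H"
  shows "H = sphere 0 1"
proof (intro equalityI sub subsetI)
  have ne: "H \<noteq> {}" using inf by auto
  have grp: "1 \<in> H" "\<And>a. a \<in> H \<Longrightarrow> inverse a \<in> H"
    using circle_closed_semigroup_group[OF cl sub ne] mult by blast+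
  have pow: "a ^ n \<in> H" if "a \<in> H" for a n
    by (induction n) (use that mult grp(1) in auto)
  have powi: "a powi k \<in> H" if "a \<in> H" for a k
    using pow[OF that] pow[OF grp(2)[OF that]] by (simp add: power_int_def)
  fix w :: complex assume w: "w \<in> sphere 0 1"
  have "w \<in> closure H"
    unfolding closure_approachable
  proof (intro allI impI)
    fix e :: real assume e: "e > 0"
    obtain x where x: "x islimpt H"
      using Heine_Borel_imp_Bolzano_Weierstrass[OF compact_sphere inf sub] by blast
    then obtain a where a: "a \<in> H" "a \<noteq> x" "dist a x < e/2"
      unfolding islimpt_approachable using e by (metis half_gt_zero)
    then obtain b where b: "b \<in> H" "b \<noteq> x" "dist b x < dist a x"
      using x unfolding islimpt_approachable by (metis zero_less_dist_iff)
    have ab: "a \<noteq> b" using b(3) by auto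
    have n: "norm a = 1" "norm b = 1" using a b sub by auto
    define \<rho> where "\<rho> = a / b"
    have \<rho>H: "\<rho> \<in> H" using mult[OF a(1) grp(2)[OF b(1)]] by (simp add: \<rho>_def divide_inverse)
    have "norm (\<rho> - 1) = dist a b"
    proof -
      have "b \<noteq> 0" using n by auto
      then have "\<rho> - 1 = (a - b) / b" by (simp add: \<rho>_def diff_divide_distrib)
      then show ?thesis using n by (simp add: norm_divide dist_norm)
    qed
    also have "\<dots> < e" using a(3) b(3) dist_triangle2[of a b x] by linarith
    finally have \<rho>e: "norm (\<rho> - 1) < e" .
    have "norm \<rho> = 1" "\<rho> \<noteq> 1" using n ab by (auto simp: \<rho>_def norm_divide)
    then obtain k where "norm (w - \<rho> powi k) \<le> norm (\<rho> - 1)"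
      using circle_powi_near[of \<rho> w] w by auto
    then show "\<exists>y\<in>H. dist y w < e"
      using powi[OF \<rho>H] \<rho>e by (metis dist_commute dist_norm order_le_less_trans)
  qed
  then show "w \<in> H" using cl by simp
qed

text \<open>A closed subsemigroup other than the whole circle is a finite group, hence the group of
  all \<open>m\<close>-th roots of unity with \<open>m\<close> its order.\<close>

lemma circle_separating_power:
  fixes H :: "complex set"
  assumes cl: "closed H" and sub: "H \<subseteq> sphere 0 1" and ne: "H \<noteq> {}"
    and mult: "\<And>a b. a \<in> H \<Longrightarrow> b \<in> H \<Longrightarrow> a * b \<in> H"
    and l: "norm l = 1" "l \<notin> H"
  obtains m :: nat where "\<And>z. z \<in> H \<Longrightarrow> z ^ m = 1" "l ^ m \<noteq> 1"
proof -
  have grp: "1 \<in> H" "\<And>a. a \<in> H \<Longrightarrow> inverse a \<in> H"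
    using circle_closed_semigroup_group[OF cl sub ne] mult by blast+
  have fin: "finite H"
  proof (rule ccontr)
    assume "infinite H"
    then have "H = sphere 0 1"
      using circle_infinite_closed_semigroup[OF cl sub] mult by blast
    then show False using l by simp
  qed
  define m where "m = card H"
  have m: "m > 0" using fin ne by (simp add: m_def card_gt_0_iff)
  have zm: "z ^ m = 1" if z: "z \<in> H" for z
  proof -
    have z0: "z \<noteq> 0" using z sub by auto
    \<comment> \<open>Multiplication by \<open>z\<close> permutes \<open>H\<close>; comparing the
      products over \<open>H\<close> before and after gives \<open>z ^ m = 1\<close>.\<close>
    have "bij_betw (\<lambda>h. z * h) H H"
    proof (rule bij_betw_byWitness[where f' = "\<lambda>h. inverse z * h"])
      show "(\<lambda>h. z * h) ` H \<subseteq> H" "(\<lambda>h. inverse z * h) ` H \<subseteq> H"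
        using mult z grp(2)[OF z] by auto
    qed (use z0 in auto)
    then have "(\<Prod>h\<in>H. z * h) = (\<Prod>h\<in>H. h)" by (rule prod.reindex_bij_betw)
    then have "z ^ m * (\<Prod>h\<in>H. h) = 1 * (\<Prod>h\<in>H. h)" by (simp add: prod.distrib m_def)
    moreover have "(\<Prod>h\<in>H. h) \<noteq> 0" using fin sub by (auto simp: prod_zero_iff)
    ultimately show ?thesis by (metis mult_right_cancel)
  qed
  have "H = {z. z ^ m = 1}"
  proof (rule card_subset_eq)
    show "finite {z::complex. z ^ m = 1}"
      by (rule finite_roots_unity) (use m in simp)
    show "card H = card {z::complex. z ^ m = 1}"
      using card_roots_unity_eq[OF m] by (simp only: m_def)
  qed (use zm in blast)
  then show thesis using that[of m] zm l(2) by blast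
qed

subsection \<open>Dense orbits in an invariant affine hyperplane\<close>

lemma subspace_closure:
  fixes S :: "'a::complex_banach set"
  assumes S: "complex_vector.subspace S"
  shows "complex_vector.subspace (closure S)"
proof (rule complex_vector.subspaceI)
  show "0 \<in> closure S"
    using closure_subset complex_vector.subspace_0[OF S] by blast
next
  fix x y assume "x \<in> closure S" "y \<in> closure S"
  then obtain a b where "\<forall>n. a n \<in> S" "a \<longlonglongrightarrow> x" "\<forall>n. b n \<in> S" "b \<longlonglongrightarrow> y"
    unfolding closure_sequential by blast
  then show "x + y \<in> closure S"
    unfolding closure_sequential using complex_vector.subspace_add[OF S]
    by (intro exI[of _ "\<lambda>n. a n + b n"]) (auto intro: tendsto_add)
next
  fix c x assume "x \<in> closure S"
  then obtain a where "\<forall>n. a n \<in> S" "a \<longlonglongrightarrow> x"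
    unfolding closure_sequential by blast
  then show "c *\<^sub>C x \<in> closure S"
    unfolding closure_sequential using complex_vector.subspace_scale[OF S]
    by (intro exI[of _ "\<lambda>n. c *\<^sub>C a n"]) (auto intro: scaleC.tendsto)
qed

text \<open>The setting for a supercyclic vector of \<open>T = l U\<close> after normalisation:
  \<open>l\<close> is the rotation split off, and \<open>eigen\<close> says that 1 is the only
  possible eigenvalue of the adjoint of \<open>U\<close>.\<close>

locale affine_orbit =
  fixes U :: "'a::complex_banach \<Rightarrow> 'a" and \<phi> :: "'a \<Rightarrow> complex" and x :: 'a and l :: complex
  assumes U: "bounded_clinear U" and \<phi>: "bounded_clinear \<phi>" and \<phi>U: "\<phi> (U y) = \<phi> y"
    and \<phi>x: "\<phi> x = 1" and l: "cmod l = 1"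
    and eigen: "\<And>(\<psi> :: 'a \<Rightarrow> complex) \<mu> y. bounded_clinear \<psi> \<Longrightarrow> (\<And>y. \<psi> (U y) = \<mu> * \<psi> y) \<Longrightarrow> \<mu> \<noteq> 1 \<Longrightarrow> \<psi> y = 0"
    and dense: "\<And>v. \<phi> v = 1 \<Longrightarrow> v \<in> closure (range (\<lambda>n. (U ^^ n) x))"
begin

definition polyU :: "complex poly \<Rightarrow> 'a \<Rightarrow> 'a"
  where "polyU p y = poly_comb (\<lambda>i. (U ^^ i) y) p"

lemma polyU_0 [simp]: "polyU 0 y = 0"
  by (simp add: polyU_def)

lemma polyU_pCons: "polyU (pCons a p) y = a *\<^sub>C y + U (polyU p y)"
  by (simp add: polyU_def poly_comb_pCons bounded_clinear_poly_comb[OF U])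

lemma polyU_add: "polyU (p + q) y = polyU p y + polyU q y"
  by (simp add: polyU_def poly_comb_add)

lemma polyU_smult: "polyU (smult c p) y = c *\<^sub>C polyU p y"
  by (simp add: polyU_def poly_comb_smult)

lemma polyU_diff: "polyU (p - q) y = polyU p y - polyU q y"
  using polyU_add[of "p - q" q y] by simp

lemma polyU_linear_factor: "polyU ([:- z, 1:] * q) y = U (polyU q y) - z *\<^sub>C polyU q y"
  by (simp add: mult_pCons_left polyU_diff polyU_smult polyU_pCons scaleC.zero_left)

lemma bounded_clinear_polyU: "bounded_clinear (polyU p)"
proof (induction p)
  case 0
  have "polyU 0 = (\<lambda>y. 0)" by (rule ext) simp
  then show ?case by (simp add: bounded_clinear_def scaleC.zero_right)
next
  case (pCons a p)
  have "polyU (pCons a p) = (\<lambda>y. a *\<^sub>C y + U (polyU p y))" by (rule ext) (rule polyU_pCons)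
  then show ?case
    using bounded_clinear_add_fun[OF bounded_clinear_scaleC_fun[OF bounded_clinear_ident]
        bounded_clinear_compose[OF U pCons.IH]] by simp
qed

lemma polyU_commute: "U (polyU p y) = polyU p (U y)"
  by (simp add: polyU_def bounded_clinear_poly_comb[OF U] flip: funpow_swap1)

lemma polyU_commute_funpow: "(U ^^ n) (polyU p y) = polyU p ((U ^^ n) y)"
  by (induction n) (auto simp: polyU_commute)

lemma \<phi>_polyU: "\<phi> (polyU p y) = poly p 1 * \<phi> y"
  by (induction p) (auto simp: polyU_pCons bounded_clinear_zero[OF \<phi>] bounded_clinear_add[OF \<phi>]
      bounded_clinear_times[OF \<phi>] \<phi>U algebra_simps)

text \<open>A functional vanishing on the range of \<open>U - z\<close> is an eigenvector of the
  adjoint for \<open>z\<close>, so by \<open>eigen\<close> it is zero; Hahn--Banach then excludes a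
  proper closure.\<close>

lemma dense_range_shifted:
  assumes "z \<noteq> 1"
  shows "closure (range (\<lambda>y. U y - z *\<^sub>C y)) = UNIV"
proof (rule ccontr)
  define S where "S y = U y - z *\<^sub>C y" for y
  have S: "bounded_clinear S"
    unfolding S_def[abs_def]
    by (intro bounded_clinear_diff_fun U bounded_clinear_scaleC_fun bounded_clinear_ident)
  assume "closure (range (\<lambda>y. U y - z *\<^sub>C y)) \<noteq> UNIV"
  then obtain a where a: "a \<notin> closure (range S)" unfolding S_def[abs_def] by blast
  have "complex_vector.subspace (range S)"
  proof (rule complex_vector.subspaceI)
    show "0 \<in> range S" using bounded_clinear_zero[OF S] by (metis rangeI)
    show "u + v \<in> range S" if "u \<in> range S" "v \<in> range S" for u v
      using that bounded_clinear_add[OF S] by (metis (no_types, lifting) imageE rangeI)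
    show "c *\<^sub>C u \<in> range S" if "u \<in> range S" for c u
      using that bounded_clinear_scaleC[OF S] by (metis (no_types, lifting) imageE rangeI)
  qed
  then have "complex_vector.subspace (closure (range S))" by (rule subspace_closure)
  then obtain \<psi> where \<psi>: "\<psi> \<in> dual_space" "\<And>y. y \<in> closure (range S) \<Longrightarrow> \<psi> y = 0" "\<psi> a = 1"
    using Hahn_Banach_separation[OF _ closed_closure a] by blast
  have b\<psi>: "bounded_clinear \<psi>" using \<psi>(1) by (simp add: dual_space_def)
  have eq: "\<psi> (U y) = z * \<psi> y" for y
  proof -
    have "\<psi> (S y) = 0" by (intro \<psi>(2) subsetD[OF closure_subset]) auto
    then show ?thesis by (simp add: S_def bounded_clinear_diff[OF b\<psi>] bounded_clinear_times[OF b\<psi>])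
  qed
  then show False using eigen[OF b\<psi> eq assms, of a] \<psi>(3) by simp
qed

text \<open>Over the complex numbers \<open>p\<close> splits into linear factors, none with root 1.
  Each factor has dense range by \<open>dense_range_shifted\<close>, and composition preserves
  this.\<close>

lemma dense_range_polyU:
  assumes "poly p 1 \<noteq> 0"
  shows "closure (range (polyU p)) = UNIV"
  using assms
proof (induction "degree p" arbitrary: p rule: less_induct)
  case less
  show ?case
  proof (cases "degree p = 0")
    case True
    then obtain c where p: "p = [:c:]" using degree_eq_zeroE by blast
    then have c: "c \<noteq> 0" using less.prems by simp
    have "polyU p ((1/c) *\<^sub>C y) = y" for y
      using c by (simp add: p polyU_pCons bounded_clinear_zero[OF U] scaleC_scaleC)
    then have "range (polyU p) = UNIV" by (metis surjI)
    then show ?thesis by simp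
  next
    case False
    then obtain z where "poly p z = 0"
      using fundamental_theorem_of_algebra[of p] by (auto simp: constant_degree)
    then obtain q where p: "p = [:- z, 1:] * q" by (auto simp: poly_eq_0_iff_dvd elim: dvdE)
    have z: "z \<noteq> 1" and q: "poly q 1 \<noteq> 0" using less.prems by (auto simp: p)
    have "q \<noteq> 0" using q by auto
    then have "degree q < degree p" unfolding p by (subst degree_mult_eq) auto
    then have IH: "closure (range (polyU q)) = UNIV" using less.hyps q by blast
    define S where "S y = U y - z *\<^sub>C y" for y
    have S: "bounded_clinear S"
      unfolding S_def[abs_def]
      by (intro bounded_clinear_diff_fun U bounded_clinear_scaleC_fun bounded_clinear_ident)
    have "polyU p = (\<lambda>y. S (polyU q y))"
      by (rule ext) (simp only: p S_def polyU_linear_factor)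
    then have "range (polyU p) = S ` range (polyU q)" by (simp add: image_image)
    moreover have "S ` closure (range (polyU q)) \<subseteq> closure (S ` range (polyU q))"
      by (rule closure_bounded_linear_image_subset[OF bounded_clinear_imp_bounded_linear[OF S]])
    ultimately have "range S \<subseteq> closure (range (polyU p))" using IH by simp
    then have "closure (range S) \<subseteq> closure (range (polyU p))" by (rule closure_minimal) simp
    then show ?thesis using dense_range_shifted[OF z] by (auto simp: S_def[abs_def])
  qed
qed

text \<open>This is a convex, \<open>U\<close>-invariant part of the hyperplane
  \<open>\<phi> = 1\<close>, all of whose points still have orbits dense in that hyperplane.\<close>

definition cyc :: "'a set"
  where "cyc = {polyU p x | p. poly p 1 = 1}"

lemma x_in_cyc: "x \<in> cyc"
  unfolding cyc_def
  by (rule CollectI, rule exI[of _ "[:1:]"]) (simp add: polyU_pCons bounded_clinear_zero[OF U])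

lemma U_cyc: "u \<in> cyc \<Longrightarrow> U u \<in> cyc"
proof -
  assume "u \<in> cyc"
  then obtain p where "u = polyU p x" "poly p 1 = 1" by (auto simp: cyc_def)
  then have "U u = polyU (pCons 0 p) x" "poly (pCons 0 p) 1 = 1"
    by (auto simp: polyU_pCons scaleC.zero_left)
  then show ?thesis unfolding cyc_def by blast
qed

lemma \<phi>_cyc: "u \<in> cyc \<Longrightarrow> \<phi> u = 1"
  by (auto simp: cyc_def \<phi>_polyU \<phi>x)

lemma convex_cyc: "convex cyc"
  unfolding convex_def
proof (intro ballI allI impI)
  fix a b and s t :: real
  assume ab: "a \<in> cyc" "b \<in> cyc" and st: "s + t = 1"
  obtain p q where p: "a = polyU p x" "poly p 1 = 1" and q: "b = polyU q x" "poly q 1 = 1"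
    using ab by (auto simp: cyc_def)
  have "s *\<^sub>R a + t *\<^sub>R b = polyU (smult (of_real s) p + smult (of_real t) q) x"
    by (simp add: polyU_add polyU_smult p q scaleC_of_real)
  moreover have "poly (smult (of_real s) p + smult (of_real t) q) 1 = 1"
    using st by (simp add: p q flip: of_real_add)
  ultimately show "s *\<^sub>R a + t *\<^sub>R b \<in> cyc" unfolding cyc_def by blast
qed

text \<open>With \<open>u = p(U) x\<close>, the operator \<open>p(U)\<close> carries the orbit of
  \<open>x\<close> to that of \<open>u\<close>, so the orbit closure of \<open>u\<close> contains
  the image of the hyperplane. Approximating \<open>v\<close> by vectors \<open>p(U) y\<close>
  forces \<open>\<phi> y\<close> towards 1, and dividing by \<open>\<phi> y\<close> moves
  \<open>y\<close> into the hyperplane.\<close>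

lemma dense_orbit_cyc:
  assumes u: "u \<in> cyc" and v: "\<phi> v = 1"
  shows "v \<in> closure (range (\<lambda>n. (U ^^ n) u))"
proof -
  obtain p where p: "u = polyU p x" "poly p 1 = 1" using u by (auto simp: cyc_def)
  let ?K = "closure (range (\<lambda>n. (U ^^ n) u))"
  have img: "polyU p y \<in> ?K" if "\<phi> y = 1" for y
  proof -
    have "polyU p ` closure (range (\<lambda>n. (U ^^ n) x)) \<subseteq> closure (polyU p ` range (\<lambda>n. (U ^^ n) x))"
      by (rule closure_bounded_linear_image_subset
          [OF bounded_clinear_imp_bounded_linear[OF bounded_clinear_polyU]])
    also have "polyU p ` range (\<lambda>n. (U ^^ n) x) = range (\<lambda>n. (U ^^ n) u)"
      by (simp add: p polyU_commute_funpow image_image)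
    finally show ?thesis using dense[OF that] by blast
  qed
  have "v \<in> closure (range (polyU p))" using dense_range_polyU[of p] p by simp
  then obtain w where w: "\<forall>n. w n \<in> range (polyU p)" "w \<longlonglongrightarrow> v"
    unfolding closure_sequential by blast
  then have "\<forall>n. \<exists>y. w n = polyU p y" by blast
  then obtain y where y: "\<And>n. w n = polyU p (y n)" by metis
  have "(\<lambda>n. \<phi> (w n)) \<longlonglongrightarrow> \<phi> v" by (rule bounded_clinear_tendsto[OF \<phi> w(2)])
  then have lim: "(\<lambda>n. \<phi> (y n)) \<longlonglongrightarrow> 1" by (simp add: y \<phi>_polyU p v)
  then have ev: "\<forall>\<^sub>F n in sequentially. \<phi> (y n) \<noteq> 0"
    by (rule tendsto_imp_eventually_ne) simp
  have "(\<lambda>n. (1 / \<phi> (y n)) *\<^sub>C w n) \<longlonglongrightarrow> (1 / 1) *\<^sub>C v"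
    by (intro scaleC.tendsto w tendsto_divide tendsto_const lim) simp
  then have "(\<lambda>n. (1 / \<phi> (y n)) *\<^sub>C w n) \<longlonglongrightarrow> v" by simp
  moreover have "\<forall>\<^sub>F n in sequentially. (1 / \<phi> (y n)) *\<^sub>C w n \<in> ?K"
    using ev
  proof eventually_elim
    case (elim n)
    have "(1 / \<phi> (y n)) *\<^sub>C w n = polyU p ((1 / \<phi> (y n)) *\<^sub>C y n)"
      by (simp add: y bounded_clinear_scaleC[OF bounded_clinear_polyU])
    then show ?case using elim by (simp add: img bounded_clinear_times[OF \<phi>])
  qed
  ultimately show ?thesis
    by (intro Lim_in_closed_set[OF closed_closure]) auto
qed

text \<open>The set \<open>{g. (g, v) \<in> R u}\<close> collects the limits of \<open>l ^ n\<close> along which \<open>U ^^ n\<close> moves \<open>u\<close> to \<open>v\<close>.\<close>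

definition R :: "'a \<Rightarrow> (complex \<times> 'a) set"
  where "R u = closure (range (\<lambda>n. (l ^ n, (U ^^ n) u)))"

lemma closed_R: "closed (R u)"
  by (simp add: R_def)

lemma R_norm: "(g, v) \<in> R u \<Longrightarrow> cmod g = 1"
proof -
  have "R u \<subseteq> sphere 0 1 \<times> UNIV"
    unfolding R_def by (rule closure_minimal) (auto simp: norm_power l intro!: closed_Times)
  then show "(g, v) \<in> R u \<Longrightarrow> cmod g = 1" by auto
qed

lemma R_step:
  assumes "(g, v) \<in> R u"
  shows "(l ^ m * g, (U ^^ m) v) \<in> R u"
proof -
  let ?f = "\<lambda>z. (l ^ m * fst z, (U ^^ m) (snd z))"
  have "?f ` R u \<subseteq> R u"
    unfolding R_def
  proof (rule image_closure_subset)
    show "continuous_on (closure (range (\<lambda>n. (l ^ n, (U ^^ n) u)))) ?f"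
      by (intro continuous_intros bounded_clinear_continuous_on[OF bounded_clinear_funpow[OF U]])
    have "(l ^ (m + n), (U ^^ (m + n)) u) \<in> closure (range (\<lambda>n. (l ^ n, (U ^^ n) u)))" for n
      by (rule subsetD[OF closure_subset]) (rule rangeI)
    then show "?f ` range (\<lambda>n. (l ^ n, (U ^^ n) u)) \<subseteq> closure (range (\<lambda>n. (l ^ n, (U ^^ n) u)))"
      by (auto simp: power_add funpow_add)
  qed simp
  then show ?thesis using assms by force
qed

text \<open>By \<open>R_step\<close> the orbit of \<open>v\<close>, with its rotations multiplied by
  \<open>g\<close>, lies in the closed set \<open>R u\<close>; its limits follow.\<close>

lemma R_trans:
  assumes "(g, v) \<in> R u" "(h, w) \<in> R v"
  shows "(g * h, w) \<in> R u"
proof -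
  let ?f = "\<lambda>z. (fst z * g, snd z)"
  have "?f ` closure (range (\<lambda>n. (l ^ n, (U ^^ n) v))) \<subseteq> R u"
  proof (rule image_closure_subset)
    show "continuous_on (closure (range (\<lambda>n. (l ^ n, (U ^^ n) v)))) ?f"
      by (intro continuous_intros)
    show "?f ` range (\<lambda>n. (l ^ n, (U ^^ n) v)) \<subseteq> R u"
      using R_step[OF assms(1)] by auto
  qed (rule closed_R)
  then show ?thesis using assms(2) by (force simp: R_def mult.commute)
qed

text \<open>Compactness of the circle provides a subsequence along which the rotations converge as
  well.\<close>

lemma R_exists:
  assumes "v \<in> closure (range (\<lambda>n. (U ^^ n) u))"
  obtains g where "(g, v) \<in> R u"
proof -
  obtain w where w: "\<forall>n. w n \<in> range (\<lambda>n. (U ^^ n) u)" "w \<longlonglongrightarrow> v"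
    using assms unfolding closure_sequential by blast
  then have "\<forall>n. \<exists>k. w n = (U ^^ k) u" by blast
  then obtain k where k: "\<And>n. w n = (U ^^ k n) u" by metis
  have "\<forall>n. l ^ k n \<in> sphere 0 1" by (simp add: norm_power l)
  then obtain g r where r: "strict_mono r" "((\<lambda>n. l ^ k n) \<circ> r) \<longlonglongrightarrow> g"
    using compact_sphere[of "0::complex" 1] unfolding compact_def by metis
  have "(w \<circ> r) \<longlonglongrightarrow> v" using w(2) r(1) by (rule LIMSEQ_subseq_LIMSEQ)
  then have "(\<lambda>n. (l ^ k (r n), (U ^^ k (r n)) u)) \<longlonglongrightarrow> (g, v)"
    using r(2) by (intro tendsto_Pair) (auto simp: o_def k)
  then have "(g, v) \<in> R u"
    unfolding R_def closure_sequential by (intro exI conjI) auto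
  then show thesis by (rule that)
qed

lemma R_cyc_exists:
  assumes "u \<in> cyc" "\<phi> v = 1"
  obtains g where "(g, v) \<in> R u"
  using R_exists[OF dense_orbit_cyc[OF assms]] by blast

section \<open>The group of return rotations\<close>

definition H :: "complex set"
  where "H = {g. (g, x) \<in> R x}"

lemma H_props:
  shows "closed H" "H \<subseteq> sphere 0 1" "H \<noteq> {}" "a \<in> H \<Longrightarrow> b \<in> H \<Longrightarrow> a * b \<in> H"
proof -
  have "closed ((\<lambda>g. (g, x)) -` R x)"
    by (intro closed_vimage closed_R continuous_intros)
  then show "closed H" by (simp add: H_def vimage_def)
  show "H \<subseteq> sphere 0 1" using R_norm by (auto simp: H_def)
  show "H \<noteq> {}" using R_cyc_exists[OF x_in_cyc \<phi>x] by (auto simp: H_def)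
  show "a \<in> H \<Longrightarrow> b \<in> H \<Longrightarrow> a * b \<in> H" using R_trans by (auto simp: H_def)
qed

text \<open>Density of the orbit near \<open>x\<close> itself could be due to time 0 alone.
  Therefore a nearby point \<open>y \<noteq> x\<close> on the segment towards \<open>U x\<close> is
  approximated instead.\<close>

lemma recurrent:
  assumes "U x \<noteq> x" "e > 0"
  obtains n where "dist ((U ^^ Suc n) x) x < e"
proof -
  define d where "d = norm (U x - x)"
  have d: "d > 0" using assms by (simp add: d_def)
  define t where "t = min 1 (e / (4 * d))"
  have t: "t > 0" "t * d \<le> e / 4" using d assms(2) by (auto simp: t_def min_def field_simps)
  define y where "y = x + t *\<^sub>R (U x - x)"
  have yx: "dist y x = t * d" using t by (simp add: y_def dist_norm d_def)
  have "y = (1 - complex_of_real t) *\<^sub>C x + complex_of_real t *\<^sub>C U x"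
    by (simp add: y_def scaleC.diff_left scaleC_of_real algebra_simps)
  then have "\<phi> y = 1"
    by (simp add: bounded_clinear_add[OF \<phi>] bounded_clinear_times[OF \<phi>] \<phi>U \<phi>x)
  then have "y \<in> closure (range (\<lambda>n. (U ^^ n) x))" by (rule dense)
  moreover have "t * d > 0" using t d by simp
  \<comment> \<open>The tolerance is exactly the distance from \<open>y\<close> to \<open>x\<close>,
    so the strict inequality rules out \<open>n = 0\<close>.\<close>
  ultimately obtain n where n: "dist ((U ^^ n) x) y < t * d"
    unfolding closure_approachable by blast
  then have "n \<noteq> 0" using yx by (auto simp: dist_commute intro!: Nat.gr0I)
  then obtain m where m: "n = Suc m" by (cases n) auto
  have "dist ((U ^^ n) x) x < e" using n yx t assms(2) dist_triangle[of "(U ^^ n) x" x y] by linarith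
  then show thesis using that m by blast
qed

text \<open>
  If \<open>l \<notin> H\<close>, some power map kills \<open>H\<close> but not \<open>l\<close>, and \<open>u \<mapsto> {g. (g, u) \<in> R x}\<close> becomes a continuous
  circle-valued eigenfunction of \<open>U\<close> on the convex set \<open>cyc\<close>. Its logarithm grows linearly along the orbit
  of \<open>x\<close>, contradicting recurrence.
\<close>

lemma l_in_H: "l \<in> H"
proof (rule ccontr)
  assume "l \<notin> H"
  then obtain m where mH: "\<And>z. z \<in> H \<Longrightarrow> z ^ m = 1" and ml: "l ^ m \<noteq> 1"
    using circle_separating_power[OF H_props(1-3) _ l] H_props(4) by blast
  define q where "q u = (SOME g. (g, u) \<in> R x) ^ m" for u
  \<comment> \<open>Continuing from \<open>u\<close> back to \<open>x\<close> with a common rotation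
    \<open>k\<close> puts both products in \<open>H\<close>, where \<open>m\<close>-th powers are 1.
    Hence the choice in \<open>q\<close> does not matter.\<close>
  have uniq: "g ^ m = g' ^ m" if u: "u \<in> cyc" and g: "(g, u) \<in> R x" "(g', u) \<in> R x" for g g' u
  proof -
    obtain k where k: "(k, x) \<in> R u" using R_cyc_exists[OF u \<phi>x] by blast
    have "g * k \<in> H" "g' * k \<in> H" using R_trans[OF _ k] g by (auto simp: H_def)
    then have "g ^ m * k ^ m = g' ^ m * k ^ m" by (metis mH power_mult_distrib)
    moreover have "k \<noteq> 0" using R_norm[OF k] by auto
    ultimately show ?thesis by simp
  qed
  have q: "q u = g ^ m" if "u \<in> cyc" "(g, u) \<in> R x" for u g
    unfolding q_def by (rule uniq[OF that(1) _ that(2)]) (rule someI, rule that(2))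
  have ex: "\<exists>g. (g, u) \<in> R x" if "u \<in> cyc" for u
    using R_cyc_exists[OF x_in_cyc \<phi>_cyc[OF that]] by blast
  have q0: "q u \<noteq> 0" if u: "u \<in> cyc" for u
  proof -
    obtain g where g: "(g, u) \<in> R x" using ex[OF u] by blast
    then show ?thesis using q[OF u g] R_norm[OF g] by auto
  qed
  have qU: "q (U u) = l ^ m * q u" if u: "u \<in> cyc" for u
  proof -
    obtain g where g: "(g, u) \<in> R x" using ex[OF u] by blast
    have "(l * g, U u) \<in> R x" using R_step[OF g, of 1] by simp
    then show ?thesis using q[OF u g] q[OF U_cyc[OF u]] by (simp add: power_mult_distrib)
  qed
  \<comment> \<open>A closed graph with values in a compact set: a subsequence violating continuity
    would have rotations converging to some \<open>c\<close> with \<open>(c, a) \<in> R x\<close>,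
    which determines \<open>q a\<close>.\<close>
  have "continuous_on cyc q"
    unfolding continuous_on_sequentially
  proof (intro allI ballI impI, elim conjE)
    fix s a assume a: "a \<in> cyc" and s: "\<forall>n. s n \<in> cyc" "s \<longlonglongrightarrow> a"
    show "(q \<circ> s) \<longlonglongrightarrow> q a"
    proof (rule ccontr)
      assume "\<not> (q \<circ> s) \<longlonglongrightarrow> q a"
      then obtain e where e: "e > 0" "\<not> (\<forall>\<^sub>F n in sequentially. dist ((q \<circ> s) n) (q a) < e)"
        unfolding tendsto_iff by blast
      obtain r :: "nat \<Rightarrow> nat" where r: "strict_mono r" "\<And>n. \<not> dist (q (s (r n))) (q a) < e"
        using not_eventually_sequentiallyD[OF e(2)] unfolding o_def by blast
      have "\<forall>n. \<exists>g. (g, s (r n)) \<in> R x" using ex s(1) by blast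
      then obtain g where g: "\<And>n. (g n, s (r n)) \<in> R x" by metis
      have "\<forall>n. g n \<in> sphere 0 1" using R_norm[OF g] by simp
      then obtain c r' where r': "strict_mono r'" "(g \<circ> r') \<longlonglongrightarrow> c"
        using compact_sphere[of "0::complex" 1] unfolding compact_def by metis
      have "(s \<circ> (r \<circ> r')) \<longlonglongrightarrow> a"
        using s(2) strict_mono_o[OF r(1) r'(1)] by (rule LIMSEQ_subseq_LIMSEQ)
      then have "(\<lambda>n. (g (r' n), s (r (r' n)))) \<longlonglongrightarrow> (c, a)"
        using r'(2) by (intro tendsto_Pair) (auto simp: o_def)
      then have "(c, a) \<in> R x"
        using closed_sequentially[OF closed_R, of "\<lambda>n. (g (r' n), s (r (r' n)))"] g by blast
      then have "q a = c ^ m" by (rule q[OF a])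
      moreover have "q (s (r (r' n))) = g (r' n) ^ m" for n using q g s(1) by blast
      moreover have "(\<lambda>n. g (r' n) ^ m) \<longlonglongrightarrow> c ^ m"
        using r'(2) by (intro tendsto_power) (simp add: o_def)
      ultimately have "(\<lambda>n. q (s (r (r' n)))) \<longlonglongrightarrow> q a" by simp
      then have "\<forall>\<^sub>F n in sequentially. dist (q (s (r (r' n)))) (q a) < e" using e(1) by (rule tendstoD)
      then show False using r(2) by (auto simp: eventually_sequentially)
    qed
  qed
  then obtain h where h: "continuous_on cyc h" "\<And>u. u \<in> cyc \<Longrightarrow> q u = exp (h u)"
    using continuous_logarithm_on_contractible[of cyc q] convex_imp_contractible[OF convex_cyc] q0
    by blast
  define D where "D u = h (U u) - h u" for u
  have expD: "exp (D u) = l ^ m" if u: "u \<in> cyc" for u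
    using qU[OF u] h(2)[OF u] h(2)[OF U_cyc[OF u]] q0[OF u] by (simp add: D_def exp_diff)
  \<comment> \<open>\<open>D\<close> takes values among the logarithms of \<open>l ^ m\<close>,
    which are at least \<open>2 * pi\<close> apart, and \<open>cyc\<close> is connected.\<close>
  have "D constant_on cyc"
  proof (rule continuous_discrete_range_constant)
    show "connected cyc" by (rule convex_connected[OF convex_cyc])
    show "continuous_on cyc D"
      unfolding D_def
      by (intro continuous_intros h continuous_on_compose2[OF h(1)] bounded_clinear_continuous_on[OF U])
        (auto intro: U_cyc)
    fix u assume u: "u \<in> cyc"
    show "\<exists>e>0. \<forall>y. y \<in> cyc \<and> D y \<noteq> D u \<longrightarrow> e \<le> norm (D y - D u)"
    proof (intro exI[of _ "2 * pi"] conjI allI impI)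
      fix y assume y: "y \<in> cyc \<and> D y \<noteq> D u"
      then have "exp (D y) = exp (D u)" using expD u by simp
      then obtain k :: int where k: "D y = D u + of_int (2 * k) * (of_real pi * \<i>)"
        unfolding exp_eq by (auto simp: algebra_simps)
      then have "k \<noteq> 0" using y by auto
      then have "1 \<le> \<bar>real_of_int k\<bar>" by linarith
      moreover have "norm (D y - D u) = 2 * pi * \<bar>real_of_int k\<bar>"
        by (simp add: k norm_mult)
      ultimately show "2 * pi \<le> norm (D y - D u)" by simp
    qed simp
  qed
  then obtain \<beta> where \<beta>: "\<And>u. u \<in> cyc \<Longrightarrow> D u = \<beta>" unfolding constant_on_def by blast
  have \<beta>0: "\<beta> \<noteq> 0" using expD[OF x_in_cyc] ml \<beta>[OF x_in_cyc] by auto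
  have orb: "(U ^^ n) x \<in> cyc" for n by (induction n) (auto simp: x_in_cyc U_cyc)
  have hn: "h ((U ^^ n) x) = h x + of_nat n * \<beta>" for n
  proof (induction n)
    case (Suc n)
    then show ?case using \<beta>[OF orb[of n]] by (simp add: D_def algebra_simps)
  qed simp
  have "U x \<noteq> x" using \<beta>[OF x_in_cyc] \<beta>0 by (auto simp: D_def)
  moreover obtain e where e: "e > 0" "\<And>y. y \<in> cyc \<Longrightarrow> dist y x < e \<Longrightarrow> dist (h y) (h x) < norm \<beta>"
    using h(1) x_in_cyc \<beta>0 unfolding continuous_on_iff by (metis zero_less_norm_iff)
  \<comment> \<open>The return time is positive, so by \<open>hn\<close> the value of
    \<open>h\<close> has moved by at least \<open>norm \<beta>\<close>.\<close>
  ultimately obtain n where "dist ((U ^^ Suc n) x) x < e" using recurrent by blast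
  then have "dist (h ((U ^^ Suc n) x)) (h x) < norm \<beta>" using e(2) orb by blast
  then have "norm (of_nat (Suc n) * \<beta>) < norm \<beta>" by (simp only: hn dist_norm add_diff_cancel_left')
  then have "real (Suc n) * norm \<beta> < 1 * norm \<beta>" by (simp only: norm_mult norm_of_nat)
  moreover have "1 * norm \<beta> \<le> real (Suc n) * norm \<beta>" by (rule mult_right_mono) auto
  ultimately show False by linarith
qed

text \<open>Some \<open>g\<close> is reached at \<open>v\<close>, and it lies in the group
  \<open>H\<close>. Returning to \<open>x\<close> first with rotation
  \<open>l powi k * inverse g\<close> corrects it to any prescribed power of
  \<open>l\<close>.\<close>

theorem joint_orbit_dense:
  assumes v: "\<phi> v = 1"
  shows "(l powi k, v) \<in> R x"
proof -
  have grp: "1 \<in> H" "\<And>a. a \<in> H \<Longrightarrow> inverse a \<in> H"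
    using circle_closed_semigroup_group[OF H_props(1-3)] H_props(4) by blast+
  have pow: "a ^ n \<in> H" if "a \<in> H" for a n
    by (induction n) (use that H_props(4) grp(1) in auto)
  have powi: "l powi k \<in> H"
    using pow[OF l_in_H] pow[OF grp(2)[OF l_in_H]] by (simp add: power_int_def)
  obtain g where g: "(g, v) \<in> R x" using R_cyc_exists[OF x_in_cyc v] by blast
  have "R x \<subseteq> H \<times> UNIV"
    unfolding R_def by (rule closure_minimal) (auto simp: pow l_in_H intro!: closed_Times H_props)
  then have gH: "g \<in> H" using g by auto
  have "l powi k * inverse g \<in> H" using powi grp(2)[OF gH] H_props(4) by blast
  then have "(l powi k * inverse g * g, v) \<in> R x" using R_trans[OF _ g] by (auto simp: H_def)
  moreover have "g \<noteq> 0" using R_norm[OF g] by auto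
  then have "l powi k * inverse g * g = l powi k" by (simp add: field_simps)
  ultimately show ?thesis by (simp only:)
qed

end


section \<open>Sufficiency: supercyclic vectors and orbits in a hyperplane\<close>

lemma supercyclic_vector_mono:
  assumes "supercyclic_vector \<Gamma> T x"
  shows "supercyclic_vector UNIV T x"
proof -
  have "closure (scaled_orbit \<Gamma> x T) \<subseteq> closure (scaled_orbit UNIV x T)"
    by (rule closure_mono) (auto simp: scaled_orbit_def)
  then show ?thesis using assms by (auto simp: supercyclic_vector_def)
qed

lemma funpow_scaleC:
  fixes U :: "'a::complex_banach \<Rightarrow> 'a"
  assumes U: "bounded_clinear U"
  shows "((\<lambda>y. l *\<^sub>C U y) ^^ n) x = l ^ n *\<^sub>C (U ^^ n) x"
  by (induction n) (auto simp: bounded_clinear_scaleC[OF U] scaleC_scaleC)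

lemma closure_functional_nonzero:
  assumes \<phi>: "bounded_clinear \<phi>" and x: "\<phi> x \<noteq> (0::complex)"
  shows "closure {y. \<phi> y \<noteq> 0} = UNIV"
proof (intro equalityI subset_UNIV subsetI)
  fix y
  show "y \<in> closure {y. \<phi> y \<noteq> 0}"
  proof (cases "\<phi> y = 0")
    case False
    then show ?thesis by (intro subsetD[OF closure_subset]) simp
  next
    case True
    have "(\<lambda>n. y + (1 / real (Suc n)) *\<^sub>R x) \<longlonglongrightarrow> y + 0 *\<^sub>R x"
      by (intro tendsto_intros LIMSEQ_Suc[OF lim_1_over_n])
    moreover have "\<phi> (y + (1 / real (Suc n)) *\<^sub>R x) \<noteq> 0" for n
    proof -
      have "\<phi> (y + t *\<^sub>R x) = of_real t * \<phi> x" for t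
        using True by (simp add: bounded_clinear_add[OF \<phi>] bounded_clinear_times[OF \<phi>]
            flip: scaleC_of_real)
      then show ?thesis using x by (simp del: of_nat_Suc)
    qed
    ultimately show ?thesis unfolding closure_sequential by (intro exI conjI) auto
  qed
qed

text \<open>Otherwise the whole scaled orbit would lie in the kernel of \<open>\<phi>\<close>, a
  proper closed subspace.\<close>

lemma supercyclic_vector_functional_nonzero:
  assumes super: "supercyclic_vector \<Gamma> T x" and \<phi>: "bounded_clinear \<phi>"
    and eig: "\<And>y. \<phi> (T y) = \<mu> * \<phi> y" and ne: "\<phi> a \<noteq> (0::complex)"
  shows "\<phi> x \<noteq> 0"
proof
  assume 0: "\<phi> x = 0"
  have n: "\<phi> ((T ^^ n) x) = 0" for n by (induction n) (auto simp: eig 0)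
  have "closed {y. \<phi> y = 0}"
    by (intro closed_Collect_eq continuous_on_const bounded_clinear_continuous_on[OF \<phi>] continuous_on_id)
  then have "closure (scaled_orbit \<Gamma> x T) \<subseteq> {y. \<phi> y = 0}"
    by (intro closure_minimal) (auto simp: scaled_orbit_def bounded_clinear_times[OF \<phi>] n)
  then show False using super ne by (auto simp: supercyclic_vector_def)
qed

text \<open>The functional reads off the scalar: it is \<open>c\<close> at
  \<open>c *\<^sub>C (U ^^ n) x\<close>. Approximating \<open>v\<close> therefore forces the scalars
  towards 1, and they can be divided out.\<close>

lemma supercyclic_hyperplane_dense:
  assumes U: "bounded_clinear U" and \<phi>: "bounded_clinear \<phi>" and \<phi>U: "\<And>y. \<phi> (U y) = \<phi> y"
    and x: "\<phi> x = (1::complex)" and super: "closure {c *\<^sub>C (U ^^ n) x | c n. True} = UNIV"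
    and v: "\<phi> v = 1"
  shows "v \<in> closure (range (\<lambda>n. (U ^^ n) x))"
proof -
  have \<phi>n: "\<phi> ((U ^^ n) x) = 1" for n by (induction n) (auto simp: \<phi>U x)
  have "v \<in> closure {c *\<^sub>C (U ^^ n) x | c n. True}" using super by simp
  then obtain w where w: "\<forall>n. w n \<in> {c *\<^sub>C (U ^^ n) x | c n. True}" "w \<longlonglongrightarrow> v"
    unfolding closure_sequential by blast
  then have "\<forall>n. \<exists>c k. w n = c *\<^sub>C (U ^^ k) x" by blast
  then obtain c k where ck: "\<And>n. w n = c n *\<^sub>C (U ^^ k n) x" by metis
  have "(\<lambda>n. \<phi> (w n)) \<longlonglongrightarrow> \<phi> v" by (rule bounded_clinear_tendsto[OF \<phi> w(2)])
  then have lim: "c \<longlonglongrightarrow> 1" by (simp add: ck bounded_clinear_times[OF \<phi>] \<phi>n v)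
  then have ev: "\<forall>\<^sub>F n in sequentially. c n \<noteq> 0" by (rule tendsto_imp_eventually_ne) simp
  have "(\<lambda>n. (1 / c n) *\<^sub>C w n) \<longlonglongrightarrow> (1 / 1) *\<^sub>C v"
    by (intro scaleC.tendsto w tendsto_divide tendsto_const lim) simp
  then have "(\<lambda>n. (1 / c n) *\<^sub>C w n) \<longlonglongrightarrow> v" by simp
  moreover have "\<forall>\<^sub>F n in sequentially. (1 / c n) *\<^sub>C w n \<in> closure (range (\<lambda>n. (U ^^ n) x))"
    using ev
  proof eventually_elim
    case (elim n)
    then have "(1 / c n) *\<^sub>C w n = (U ^^ k n) x" by (simp add: ck scaleC_scaleC)
    then show ?case by (intro subsetD[OF closure_subset]) simp
  qed
  ultimately show ?thesis by (intro Lim_in_closed_set[OF closed_closure]) auto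
qed

text \<open>After normalising the eigenfunctional at \<open>x\<close> and rotating its eigenvalue
  away, \<open>joint_orbit_dense\<close> applies. It puts all multiples of hyperplane vectors by
  \<open>times_rotations\<close> scalars into the orbit closure, hence all \<open>y\<close> with
  \<open>\<phi> y \<noteq> 0\<close>.\<close>

theorem supercyclic_vector_of_dense_times_rotations:
  fixes T :: "'a::complex_banach \<Rightarrow> 'a"
  assumes rotations: "closure (times_rotations \<Gamma> \<theta>) = UNIV" and T: "bounded_clinear T"
    and spec: "adjoint_point_spectrum T = {cis \<theta>}" and super: "supercyclic_vector UNIV T x"
  shows "supercyclic_vector \<Gamma> T x"
proof -
  have "cis \<theta> \<in> adjoint_point_spectrum T" using spec by simp
  then obtain f where f: "bounded_clinear f" "f \<noteq> (\<lambda>x. 0)" "f \<circ> T = (\<lambda>x. cis \<theta> * f x)"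
    unfolding adjoint_point_spectrum_def dual_space_def adjoint_op_def by blast
  have fT: "f (T y) = cis \<theta> * f y" for y using f(3) by (metis comp_apply)
  obtain a where "f a \<noteq> 0" using f(2) by auto
  then have fx: "f x \<noteq> 0" by (rule supercyclic_vector_functional_nonzero[OF super f(1) fT])
  define \<phi> where "\<phi> y = (1 / f x) * f y" for y
  have \<phi>: "bounded_clinear \<phi>"
    unfolding \<phi>_def[abs_def] by (rule bounded_clinear_mult_const[OF f(1)])
  define U where "U y = cis (- \<theta>) *\<^sub>C T y" for y
  have U: "bounded_clinear U" unfolding U_def[abs_def] by (rule bounded_clinear_scaleC_fun[OF T])
  have TU: "T = (\<lambda>y. cis \<theta> *\<^sub>C U y)" by (rule ext) (simp add: U_def scaleC_scaleC cis_mult)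
  have \<phi>U: "\<phi> (U y) = \<phi> y" for y
    by (simp add: \<phi>_def U_def bounded_clinear_times[OF f(1)] fT cis_mult flip: mult.assoc)
  have \<phi>x: "\<phi> x = 1" using fx by (simp add: \<phi>_def)
  have Tn: "(T ^^ n) y = cis \<theta> ^ n *\<^sub>C (U ^^ n) y" for n y
    unfolding TU by (rule funpow_scaleC[OF U])
  have "scaled_orbit UNIV x T \<subseteq> {c *\<^sub>C (U ^^ n) x | c n. True}"
    by (auto simp: scaled_orbit_def Tn scaleC_scaleC)
  then have "closure {c *\<^sub>C (U ^^ n) x | c n. True} = UNIV"
    using super closure_mono[of "scaled_orbit UNIV x T"] unfolding supercyclic_vector_def by blast
  note hyp = supercyclic_hyperplane_dense[OF U \<phi> \<phi>U \<phi>x this]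
  interpret affine_orbit U \<phi> x "cis \<theta>"
  proof
    fix \<psi> :: "'a \<Rightarrow> complex" and \<mu> y
    assume \<psi>: "bounded_clinear \<psi>" "\<And>y. \<psi> (U y) = \<mu> * \<psi> y" and \<mu>: "\<mu> \<noteq> 1"
    show "\<psi> y = 0"
    proof (rule ccontr)
      assume "\<psi> y \<noteq> 0"
      then have "\<psi> \<noteq> (\<lambda>x. 0)" by auto
      moreover have "\<psi> \<circ> T = (\<lambda>y. (cis \<theta> * \<mu>) * \<psi> y)"
        by (rule ext) (simp add: TU bounded_clinear_times[OF \<psi>(1)] \<psi>(2))
      ultimately have "cis \<theta> * \<mu> \<in> adjoint_point_spectrum T"
        using \<psi>(1) by (auto simp: adjoint_point_spectrum_def dual_space_def adjoint_op_def)
      then show False using \<mu> spec by (auto simp: cis_neq_zero)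
    qed
  qed (use U \<phi> \<phi>U \<phi>x hyp in auto)
  let ?K = "closure (scaled_orbit \<Gamma> x T)"
  \<comment> \<open>The continuous map \<open>(g, w) \<mapsto> (\<gamma> * g) *\<^sub>C w\<close>
    sends the joint orbit of rotation and vector into the scaled orbit of \<open>T\<close>.\<close>
  have rot: "(\<gamma> * (cis \<theta> powi k)) *\<^sub>C v \<in> ?K" if \<gamma>: "\<gamma> \<in> \<Gamma>" and v: "\<phi> v = 1" for \<gamma> k v
  proof -
    let ?f = "\<lambda>z. (\<gamma> * fst z) *\<^sub>C snd z"
    have "?f ` closure (range (\<lambda>n. (cis \<theta> ^ n, (U ^^ n) x))) \<subseteq> ?K"
    proof (rule image_closure_subset)
      show "continuous_on (closure (range (\<lambda>n. (cis \<theta> ^ n, (U ^^ n) x)))) ?f"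
        by (intro continuous_intros scaleC.continuous_on)
      have "(\<gamma> * cis \<theta> ^ n) *\<^sub>C (U ^^ n) x = \<gamma> *\<^sub>C (T ^^ n) x" for n
        by (simp add: Tn scaleC_scaleC)
      then have "(\<gamma> * cis \<theta> ^ n) *\<^sub>C (U ^^ n) x \<in> scaled_orbit \<Gamma> x T" for n
        using \<gamma> unfolding scaled_orbit_def by blast
      then show "?f ` range (\<lambda>n. (cis \<theta> ^ n, (U ^^ n) x)) \<subseteq> ?K"
        by (intro subset_trans[OF _ closure_subset]) auto
    qed simp
    then show ?thesis using joint_orbit_dense[OF v, of k] by (force simp: R_def)
  qed
  have "y \<in> ?K" if y: "\<phi> y \<noteq> 0" for y
  proof -
    define v where "v = (1 / \<phi> y) *\<^sub>C y"
    have v: "\<phi> v = 1" using y by (simp add: v_def bounded_clinear_times[OF \<phi>])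
    have "(\<lambda>c. c *\<^sub>C v) ` closure (times_rotations \<Gamma> \<theta>) \<subseteq> ?K"
    proof (rule image_closure_subset)
      show "continuous_on (closure (times_rotations \<Gamma> \<theta>)) (\<lambda>c. c *\<^sub>C v)"
        by (intro scaleC.continuous_on continuous_intros)
      show "(\<lambda>c. c *\<^sub>C v) ` times_rotations \<Gamma> \<theta> \<subseteq> ?K"
        using rot[OF _ v] by (auto simp: times_rotations_def rotation_group_def cis_power_int)
    qed simp
    then have "\<phi> y *\<^sub>C v \<in> ?K" by (rule subsetD) (rule image_eqI[of _ _ "\<phi> y"], simp_all add: rotations)
    then show ?thesis using y by (simp add: v_def scaleC_scaleC)
  qed
  then have "closure {y. \<phi> y \<noteq> 0} \<subseteq> ?K" by (intro closure_minimal) auto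
  moreover have "closure {y. \<phi> y \<noteq> 0} = UNIV"
    by (rule closure_functional_nonzero[OF \<phi>, of x]) (simp add: \<phi>x)
  ultimately show ?thesis unfolding supercyclic_vector_def by (simp add: top.extremum_unique)
qed

subsection \<open>Biorthogonal sequences in separable spaces\<close>

lemma separable_dense_sequence:
  assumes "separable_space (euclidean :: 'a::metric_space topology)"
  obtains d :: "nat \<Rightarrow> 'a::metric_space" where "closure (range d) = UNIV"
proof -
  obtain C :: "'a set" where C: "countable C" "closure C = UNIV"
    using assms by (auto simp: separable_space_def)
  then have "C \<noteq> {}" by auto
  then have "range (from_nat_into C) = C" using C(1) by (rule range_from_nat_into)
  then show thesis using that C(2) by metis
qed

text \<open>
  Starting from a dense sequence \<open>d\<close>, remove one direction at a time: \<open>e n\<close> is the image under the current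
  projection \<open>P n\<close> of the first \<open>d m\<close> that \<open>P n\<close> does not kill.
\<close>

lemma biorthogonal_sequence:
  assumes sep: "separable_space (euclidean :: 'a::complex_banach topology)"
    and inf: "\<nexists>B :: 'a::complex_banach set. finite B \<and> cspan B = UNIV"
  obtains e :: "nat \<Rightarrow> 'a::complex_banach" and f :: "nat \<Rightarrow> 'a \<Rightarrow> complex"
  where "\<And>n. bounded_clinear (f n)" "\<And>m n. f m (e n) = (if m = n then 1 else 0)"
    "closure (cspan (range e)) = UNIV"
proof -
  obtain d :: "nat \<Rightarrow> 'a" where d: "closure (range d) = UNIV"
    using separable_dense_sequence[OF sep] by blast
  define idx where "idx P = (LEAST m. P (d m) \<noteq> 0)" for P :: "'a \<Rightarrow> 'a"
  define E where "E P = P (d (idx P))" for P :: "'a \<Rightarrow> 'a"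
  define G where "G a = (SOME \<psi>. bounded_clinear \<psi> \<and> \<psi> a = (1::complex))" for a :: 'a
  \<comment> \<open>This is Gram--Schmidt with Hahn--Banach functionals instead of an inner product:
    the component of \<open>Q y\<close> along \<open>E Q\<close> is measured by
    \<open>G (E Q)\<close>.\<close>
  define P where "P = rec_nat (\<lambda>y. y) (\<lambda>n Q y. Q y - G (E Q) (Q y) *\<^sub>C E Q)"
  define e where "e n = E (P n)" for n
  define f where "f n y = G (e n) (P n y)" for n y
  have P0: "P 0 = (\<lambda>y. y)" by (simp add: P_def)
  have PS: "P (Suc n) y = P n y - f n y *\<^sub>C e n" for n y by (simp add: P_def f_def e_def)
  have expand: "y = P n y + (\<Sum>i<n. f i y *\<^sub>C e i)" for n y
    by (induction n) (auto simp: P0 PS)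
  have G: "bounded_clinear (G a) \<and> G a a = 1" if a: "a \<noteq> 0" for a
  proof -
    obtain \<psi> where "\<psi> \<in> dual_space" "\<psi> a = 1"
      using Hahn_Banach_nonzero[OF a] by blast
    then have "bounded_clinear \<psi> \<and> \<psi> a = 1" by (simp add: dual_space_def)
    then show ?thesis unfolding G_def by (rule someI[where P = "\<lambda>\<psi>. bounded_clinear \<psi> \<and> \<psi> a = 1"])
  qed
  \<comment> \<open>Otherwise \<open>P n\<close> vanishes everywhere and finitely many
    \<open>e i\<close> span the space. Boundedness is a hypothesis because the induction proving it
    for \<open>P n\<close> uses this fact.\<close>
  have ex: "\<exists>m. Q (d m) \<noteq> 0" if Q: "bounded_clinear Q" and Qn: "Q = P n" for Q n
  proof (rule ccontr)
    assume "\<nexists>m. Q (d m) \<noteq> 0"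
    then have "range d \<subseteq> {y. Q y = 0}" by auto
    moreover have "closed {y. Q y = 0}"
      by (intro closed_Collect_eq continuous_on_const bounded_clinear_continuous_on[OF Q] continuous_on_id)
    ultimately have "closure (range d) \<subseteq> {y. Q y = 0}" by (rule closure_minimal)
    then have Q0: "Q y = 0" for y using d by auto
    have "y \<in> cspan (e ` {..<n})" for y
    proof -
      have "y = (\<Sum>i<n. f i y *\<^sub>C e i)" using expand[of y n] Q0[of y] Qn by simp
      moreover have "(\<Sum>i<n. f i y *\<^sub>C e i) \<in> cspan (e ` {..<n})"
        by (intro complex_vector.span_sum complex_vector.span_scale complex_vector.span_base) auto
      ultimately show ?thesis by simp
    qed
    then have "cspan (e ` {..<n}) = UNIV" by blast
    then show False using inf by (metis finite_imageI finite_lessThan)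
  qed
  have P: "bounded_clinear (P n)" for n
  proof (induction n)
    case 0
    then show ?case by (simp only: P0 bounded_clinear_ident)
  next
    case (Suc n)
    have "e n \<noteq> 0" using LeastI_ex[OF ex[OF Suc refl]] by (simp add: e_def E_def idx_def)
    then have "bounded_clinear (G (e n))" using G by blast
    then have "bounded_clinear (f n)"
      unfolding f_def[abs_def] by (rule bounded_clinear_compose[OF _ Suc])
    then have "bounded_clinear (\<lambda>y. P n y - f n y *\<^sub>C e n)"
      by (intro bounded_clinear_diff_fun Suc bounded_clinear_functional_scaleC)
    then show ?case by (simp only: PS[abs_def])
  qed
  have e0: "e n \<noteq> 0" for n
    using LeastI_ex[OF ex[OF P refl]] by (simp add: e_def E_def idx_def)
  have bf: "bounded_clinear (f n)" for n
    unfolding f_def[abs_def] using bounded_clinear_compose[OF _ P] G[OF e0] by blast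
  \<comment> \<open>With \<open>expand\<close> this makes \<open>P n\<close> idempotent; as
    \<open>e n\<close> lies in the range of \<open>P n\<close>, it also gives the half
    \<open>m < n\<close> of biorthogonality.\<close>
  have fP: "f m (P n y) = 0" if "m < n" for m n y
    using that
  proof (induction n arbitrary: m y)
    case (Suc n)
    have small: "f m (P n z) = 0" if "m < n" for m z using Suc.IH that by blast
    have idem: "P n (P n z) = P n z" for z
      using expand[of "P n z" n] small by (simp add: scaleC.zero_left)
    have fe: "f n (e n) = 1" using idem[of "d (idx (P n))"] G[OF e0] by (simp add: f_def e_def E_def)
    show ?case
    proof (cases "m = n")
      case True
      have "f n (P n y) = f n y" by (simp add: f_def idem)
      then show ?thesis
        using True fe by (simp add: PS bounded_clinear_diff[OF bf] bounded_clinear_times[OF bf])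
    next
      case False
      then have m: "m < n" using Suc.prems by simp
      have "f m (e n) = 0" using small[OF m] by (simp add: e_def E_def)
      then show ?thesis
        using small[OF m] by (simp add: PS bounded_clinear_diff[OF bf] bounded_clinear_times[OF bf])
    qed
  qed simp
  have idem: "P m (P n z) = P n z" if "m \<le> n" for m n z
    using expand[of "P n z" m] fP that by (simp add: scaleC.zero_left)
  have fe: "f n (e n) = 1" for n
    using idem[of n n "d (idx (P n))"] G[OF e0] by (simp add: f_def e_def E_def)
  have PSe: "P (Suc n) (e n) = 0" for n
    using idem[of n n "d (idx (P n))"] by (simp add: PS fe) (simp add: e_def E_def)
  have Pe: "P m (e n) = 0" if "n < m" for m n
    using that
  proof (induction m)
    case (Suc m)
    show ?case
    proof (cases "n = m")
      case False
      then have 0: "P m (e n) = 0" using Suc by simp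
      then have "f m (e n) = 0" using G[OF e0] by (simp add: f_def bounded_clinear_zero)
      then show ?thesis using 0 by (simp add: PS scaleC.zero_left)
    qed (simp add: PSe)
  qed simp
  have bi: "f m (e n) = (if m = n then 1 else 0)" for m n
  proof (cases m n rule: linorder_cases)
    case less
    then show ?thesis using fP[OF less] by (simp add: e_def E_def)
  next
    case greater
    then show ?thesis using Pe[OF greater] G[OF e0] by (simp add: f_def bounded_clinear_zero)
  qed (simp add: fe)
  \<comment> \<open>If \<open>P n (d n) \<noteq> 0\<close>, then \<open>idx\<close> selects
    \<open>n\<close> itself and the next projection removes this vector. Hence \<open>expand\<close>
    writes each \<open>d m\<close> as a finite combination of the \<open>e i\<close>.\<close>
  have kill: "\<forall>m<n. P n (d m) = 0" for n
  proof (induction n)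
    case (Suc n)
    have mono: "P (Suc n) y = 0" if "P n y = 0" for y
    proof -
      have "f n y = 0" using that G[OF e0] by (simp add: f_def bounded_clinear_zero)
      then show ?thesis using that by (simp add: PS scaleC.zero_left)
    qed
    have "P (Suc n) (d n) = 0"
    proof (cases "P n (d n) = 0")
      case False
      have "idx (P n) \<le> n" unfolding idx_def using False by (rule Least_le)
      moreover have "\<not> idx (P n) < n"
        using Suc LeastI_ex[OF ex[OF P refl], of n] unfolding idx_def by blast
      ultimately have "e n = P n (d n)" by (simp add: e_def E_def)
      then show ?thesis using G[OF e0[of n]] by (simp add: PS f_def)
    qed (rule mono)
    then show ?case using Suc mono less_Suc_eq by auto
  qed simp
  have "d m \<in> cspan (range e)" for m
  proof -
    have "d m = (\<Sum>i<Suc m. f i (d m) *\<^sub>C e i)" using expand[of "d m" "Suc m"] kill[of "Suc m"] by simp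
    moreover have "(\<Sum>i<Suc m. f i (d m) *\<^sub>C e i) \<in> cspan (range e)"
      by (intro complex_vector.span_sum complex_vector.span_scale complex_vector.span_base) auto
    ultimately show ?thesis by simp
  qed
  then have "closure (range d) \<subseteq> closure (cspan (range e))" by (intro closure_mono) auto
  then have "closure (cspan (range e)) = UNIV" using d by auto
  then show thesis using that bf bi by blast
qed

subsection \<open>Translation of polynomials\<close>

definition shift_poly :: "complex \<Rightarrow> complex poly \<Rightarrow> complex poly"
  where "shift_poly a p = pcompose p [:a, 1:]"

lemma shift_poly_shift_poly: "shift_poly a (shift_poly b p) = shift_poly (a + b) p"
  by (simp add: shift_poly_def pcompose_assoc[symmetric] pcompose_pCons add.commute)

lemma shift_poly_0: "shift_poly 0 p = p"
  by (simp add: shift_poly_def pcompose_idR)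

lemma degree_shift_poly: "degree (shift_poly a p) = degree p"
  by (simp add: shift_poly_def degree_pcompose)

lemma pcompose_power: "pcompose (p ^ n) q = pcompose p q ^ n" for p q :: "'a::comm_semiring_1 poly"
  by (induction n) (simp_all add: pcompose_mult pcompose_1)

text \<open>Convergence is coefficientwise only; degree bounds are supplied separately by
  \<open>degree_near_poly\<close> and \<open>degree_far_poly\<close>.\<close>

definition conv_poly :: "(nat \<Rightarrow> complex poly) \<Rightarrow> complex poly \<Rightarrow> bool"
  where "conv_poly P Q \<longleftrightarrow> (\<forall>i. (\<lambda>n. coeff (P n) i) \<longlonglongrightarrow> coeff Q i)"

lemma conv_poly_const: "conv_poly (\<lambda>n. p) p"
  by (simp add: conv_poly_def)

lemma conv_poly_0: "conv_poly (\<lambda>n. 0) 0"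
  by (simp add: conv_poly_def)

lemma conv_poly_pCons: "a \<longlonglongrightarrow> b \<Longrightarrow> conv_poly P Q \<Longrightarrow> conv_poly (\<lambda>n. pCons (a n) (P n)) (pCons b Q)"
  by (auto simp: conv_poly_def coeff_pCons split: nat.split)

lemma conv_poly_mult:
  "conv_poly P Q \<Longrightarrow> conv_poly P' Q' \<Longrightarrow> conv_poly (\<lambda>n. P n * P' n) (Q * Q')"
  by (auto simp: conv_poly_def coeff_mult intro!: tendsto_sum tendsto_mult)

lemma conv_poly_power: "conv_poly P Q \<Longrightarrow> conv_poly (\<lambda>n. P n ^ k) (Q ^ k)"
  by (induction k) (auto simp: conv_poly_const conv_poly_mult)

text \<open>
  The polynomials \<open>x^j (1 - x/m)^(j+1)\<close> and \<open>(x - m)^j (x/m)^(j+1)\<close> with \<open>m = n + 1\<close> approximate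
  \<open>x^j\<close> near one of the points \<open>0, m\<close> and \<open>0\<close> near the other.
\<close>

definition near_poly :: "nat \<Rightarrow> nat \<Rightarrow> complex poly"
  where "near_poly j n = monom 1 j * [:1, - (1 / of_nat (Suc n)):] ^ Suc j"

definition far_poly :: "nat \<Rightarrow> nat \<Rightarrow> complex poly"
  where "far_poly j n = [:0, -1, 1 / of_nat (Suc n):] ^ j * [:0, 1 / of_nat (Suc n):]"

lemma inverse_of_nat_Suc_tendsto: "(\<lambda>n. 1 / of_nat (Suc n) :: complex) \<longlonglongrightarrow> 0"
  by (rule LIMSEQ_Suc[OF lim_1_over_n])

text \<open>Pairing each factor \<open>x + m\<close> with a factor \<open>- x/m\<close> removes the
  growth in \<open>m\<close>. The exponent \<open>Suc j\<close> leaves one unpaired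
  \<open>- x/m\<close>, which drives the limit to zero.\<close>

lemma shift_near_poly:
  "shift_poly (of_nat (Suc n)) (near_poly j n)
    = [:0, -1, - (1 / of_nat (Suc n)):] ^ j * [:0, - (1 / of_nat (Suc n)):]"
proof -
  define m where "m = (of_nat (Suc n) :: complex)"
  have m: "m \<noteq> 0" by (simp add: m_def del: of_nat_Suc)
  have "shift_poly m (near_poly j n) = [:m, 1:] ^ j * [:0, - (1 / m):] ^ Suc j"
    using m unfolding m_def[symmetric] near_poly_def shift_poly_def
    by (simp add: pcompose_mult pcompose_power pcompose_pCons monom_altdef flip: m_def del: of_nat_Suc power_Suc)
  also have "\<dots> = ([:m, 1:] * [:0, - (1 / m):]) ^ j * [:0, - (1 / m):]"
    by (simp only: power_Suc2 power_mult_distrib mult.assoc)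
  also have "[:m, 1:] * [:0, - (1 / m):] = [:0, -1, - (1 / m):]" using m by simp
  finally show ?thesis by (simp only: m_def)
qed

lemma shift_far_poly:
  "shift_poly (of_nat (Suc n)) (far_poly j n) = monom 1 j * [:1, 1 / of_nat (Suc n):] ^ Suc j"
proof -
  define m where "m = (of_nat (Suc n) :: complex)"
  have m: "m \<noteq> 0" by (simp add: m_def del: of_nat_Suc)
  have 1: "pcompose [:0, -1, 1 / m:] [:m, 1:] = [:0, 1:] * [:1, 1 / m:]"
    using m by (simp add: pcompose_pCons)
  have 2: "pcompose [:0, 1 / m:] [:m, 1:] = [:1, 1 / m:]"
    using m by (simp add: pcompose_pCons)
  have "shift_poly m (far_poly j n) = ([:0, 1:] * [:1, 1 / m:]) ^ j * [:1, 1 / m:]"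
    unfolding far_poly_def shift_poly_def m_def[symmetric] pcompose_mult pcompose_power 1 2 ..
  also have "\<dots> = monom 1 j * [:1, 1 / m:] ^ Suc j"
    by (simp only: power_Suc2 power_mult_distrib mult.assoc monom_altdef smult_1_left)
  finally show ?thesis by (simp only: m_def)
qed

lemma conv_near_poly: "conv_poly (near_poly j) (monom 1 j)"
proof -
  have "conv_poly (near_poly j) (monom 1 j * [:1, - 0:] ^ Suc j)"
    unfolding near_poly_def[abs_def]
    by (intro conv_poly_mult conv_poly_power conv_poly_pCons conv_poly_0 conv_poly_const
        tendsto_const tendsto_minus inverse_of_nat_Suc_tendsto)
  then show ?thesis by (simp flip: one_pCons)
qed

lemma conv_shift_near_poly: "conv_poly (\<lambda>n. shift_poly (of_nat (Suc n)) (near_poly j n)) 0"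
proof -
  have "conv_poly (\<lambda>n. shift_poly (of_nat (Suc n)) (near_poly j n)) ([:0, -1, - 0:] ^ j * [:0, - 0:])"
    unfolding shift_near_poly
    by (intro conv_poly_mult conv_poly_power conv_poly_pCons conv_poly_0 conv_poly_const
        tendsto_const tendsto_minus inverse_of_nat_Suc_tendsto)
  then show ?thesis by simp
qed

lemma conv_far_poly: "conv_poly (far_poly j) 0"
proof -
  have "conv_poly (far_poly j) ([:0, -1, 0:] ^ j * [:0, 0:])"
    unfolding far_poly_def[abs_def]
    by (intro conv_poly_mult conv_poly_power conv_poly_pCons conv_poly_0 conv_poly_const
        tendsto_const inverse_of_nat_Suc_tendsto)
  then show ?thesis by simp
qed

lemma conv_shift_far_poly: "conv_poly (\<lambda>n. shift_poly (of_nat (Suc n)) (far_poly j n)) (monom 1 j)"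
proof -
  have "conv_poly (\<lambda>n. shift_poly (of_nat (Suc n)) (far_poly j n)) (monom 1 j * [:1, 0:] ^ Suc j)"
    unfolding shift_far_poly
    by (intro conv_poly_mult conv_poly_power conv_poly_pCons conv_poly_0 conv_poly_const
        tendsto_const inverse_of_nat_Suc_tendsto)
  then show ?thesis by (simp flip: one_pCons)
qed

lemma degree_near_poly: "degree (near_poly j n) \<le> Suc (2 * j)"
proof -
  have "degree (near_poly j n) \<le> degree (monom (1::complex) j)
      + degree ([:1, - (1 / of_nat (Suc n)):] ^ Suc j :: complex poly)"
    unfolding near_poly_def by (rule degree_mult_le)
  also have "\<dots> \<le> j + 1 * Suc j"
    by (intro add_mono degree_monom_le order_trans[OF degree_power_le] mult_right_mono) auto
  finally show ?thesis by simp
qed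

lemma degree_far_poly: "degree (far_poly j n) \<le> Suc (2 * j)"
proof -
  have "degree (far_poly j n) \<le> degree ([:0, -1, 1 / of_nat (Suc n):] ^ j :: complex poly)
      + degree ([:0, 1 / of_nat (Suc n):] :: complex poly)"
    unfolding far_poly_def by (rule degree_mult_le)
  also have "\<dots> \<le> 2 * j + 1"
    by (intro add_mono order_trans[OF degree_power_le] mult_right_mono) auto
  finally show ?thesis by simp
qed

subsection \<open>A supercyclic operator fixing a functional\<close>

text \<open>Each weight dominates \<open>c j\<close> times the binomial sum of the earlier weighted
  norms, which bounds the off-diagonal part of the translation; the summand 1 keeps weights away
  from zero.\<close>

fun weight :: "(nat \<Rightarrow> real) \<Rightarrow> (nat \<Rightarrow> real) \<Rightarrow> nat \<Rightarrow> real"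
  where "weight c N j = 1 + c j * (\<Sum>i<j. real (j choose i) * (weight c N i * N i))"

declare weight.simps [simp del]

lemma weight_ge_1:
  assumes "\<And>j. c j \<ge> 0" "\<And>j. N j \<ge> 0"
  shows "weight c N j \<ge> 1"
proof (induction j rule: less_induct)
  case (less j)
  have "(\<Sum>i<j. real (j choose i) * (weight c N i * N i)) \<ge> 0"
    using less assms(2) by (intro sum_nonneg mult_nonneg_nonneg) (auto intro: order_trans[of 0 1])
  then show ?case using assms(1)[of j] by (subst weight.simps) simp
qed

lemma bounded_clinear_rank_one_series:
  fixes g :: "nat \<Rightarrow> 'a::complex_banach \<Rightarrow> complex" and d :: "nat \<Rightarrow> 'a"
  assumes g: "\<And>j. bounded_clinear (g j)"
    and bound: "\<And>j y. norm (g j y) * norm (d j) \<le> (1/2) ^ j * norm y"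
  shows "summable (\<lambda>j. g j y *\<^sub>C d j)" "bounded_clinear (\<lambda>y. \<Sum>j. g j y *\<^sub>C d j)"
proof -
  have geo: "summable (\<lambda>j. (1/2) ^ j * norm y)" for y :: 'a
    by (intro summable_mult2 summable_geometric) simp
  have nle: "norm (g j y *\<^sub>C d j) \<le> (1/2) ^ j * norm y" for j y
    using bound[of j y] by (simp add: norm_scaleC)
  have sn: "summable (\<lambda>j. norm (g j y *\<^sub>C d j))" for y
    by (rule summable_comparison_test'[OF geo, of 0]) (use nle in auto)
  then show s: "summable (\<lambda>j. g j y *\<^sub>C d j)" for y
    by (rule summable_norm_cancel)
  show "bounded_clinear (\<lambda>y. \<Sum>j. g j y *\<^sub>C d j)"
  proof (rule bounded_clinearI)
    show "(\<Sum>j. g j (x + y) *\<^sub>C d j) = (\<Sum>j. g j x *\<^sub>C d j) + (\<Sum>j. g j y *\<^sub>C d j)" for x y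
      by (simp add: bounded_clinear_add[OF g] scaleC_add_left suminf_add[OF s s])
    show "(\<Sum>j. g j (c *\<^sub>C x) *\<^sub>C d j) = c *\<^sub>C (\<Sum>j. g j x *\<^sub>C d j)" for c x
    proof -
      have "c *\<^sub>C (\<Sum>j. g j x *\<^sub>C d j) = (\<Sum>j. c *\<^sub>C (g j x *\<^sub>C d j))"
        by (rule bounded_linear.suminf[OF scaleC.bounded_linear_right s])
      then show ?thesis by (simp only: bounded_clinear_times[OF g] scaleC_scaleC)
    qed
    show "norm (\<Sum>j. g j y *\<^sub>C d j) \<le> norm y * 2" for y
    proof -
      have "norm (\<Sum>j. g j y *\<^sub>C d j) \<le> (\<Sum>j. norm (g j y *\<^sub>C d j))" by (rule summable_norm[OF sn])
      also have "\<dots> \<le> (\<Sum>j. (1/2) ^ j * norm y)" by (intro suminf_le sn geo nle)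
      also have "\<dots> = (\<Sum>j. (1/2) ^ j) * norm y"
        by (intro suminf_mult2[symmetric] summable_geometric) simp
      finally show ?thesis by (simp add: suminf_geometric mult.commute)
    qed
  qed
qed

text \<open>Here \<open>v j\<close> plays the monomial of degree \<open>j\<close>, so
  \<open>Uv\<close> is the binomial expansion of its translate by 1; \<open>e0\<close> is a separate
  fixed vector on which \<open>\<phi>\<close> does not vanish.\<close>

locale translation_operator =
  fixes U :: "'a::complex_banach \<Rightarrow> 'a" and \<phi> :: "'a \<Rightarrow> complex" and e0 :: 'a and v :: "nat \<Rightarrow> 'a"
  assumes U: "bounded_clinear U" and \<phi>: "bounded_clinear \<phi>" and \<phi>U: "\<phi> (U y) = \<phi> y"
    and \<phi>e0: "\<phi> e0 = 1" and Ue0: "U e0 = e0"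
    and Uv: "U (v j) = (\<Sum>i\<le>j. of_nat (j choose i) *\<^sub>C v i)"
    and dense: "closure (cspan (insert e0 (range v))) = UNIV"
begin

text \<open>\<open>U\<close> is triangular on the \<open>v j\<close> with diagonal entries 1. An
  eigenfunctional for another eigenvalue vanishes on them by induction, and at the fixed vector
  \<open>e0\<close>, hence everywhere by density.\<close>

lemma adjoint_point_spectrum_eq: "adjoint_point_spectrum U = {1}"
proof (intro equalityI subsetI)
  fix \<mu> :: complex assume "\<mu> \<in> {1}"
  moreover have "\<phi> \<noteq> (\<lambda>x. 0)" using \<phi>e0 by auto
  moreover have "\<phi> \<circ> U = (\<lambda>x. 1 * \<phi> x)" by (rule ext) (simp add: \<phi>U)
  ultimately show "\<mu> \<in> adjoint_point_spectrum U"
    using \<phi> unfolding adjoint_point_spectrum_def dual_space_def adjoint_op_def by blast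
next
  fix \<mu> assume "\<mu> \<in> adjoint_point_spectrum U"
  then obtain \<psi> where \<psi>: "bounded_clinear \<psi>" "\<psi> \<noteq> (\<lambda>x. 0)" "\<psi> \<circ> U = (\<lambda>x. \<mu> * \<psi> x)"
    unfolding adjoint_point_spectrum_def dual_space_def adjoint_op_def by blast
  have eq: "\<psi> (U y) = \<mu> * \<psi> y" for y using \<psi>(3) by (metis comp_apply)
  show "\<mu> \<in> {1}"
  proof (rule ccontr)
    assume "\<mu> \<notin> {1}"
    then have zero: "\<psi> y = 0" if "\<psi> (U y) = \<psi> y" for y using eq[of y] that by simp
    have "\<psi> (v j) = 0" for j
    proof (induction j rule: less_induct)
      case (less j)
      have "\<psi> (U (v j)) = (\<Sum>i\<le>j. of_nat (j choose i) * \<psi> (v i))"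
        by (simp add: Uv bounded_clinear_sum[OF \<psi>(1)] bounded_clinear_times[OF \<psi>(1)])
      also have "\<dots> = (\<Sum>i\<le>j. if i = j then \<psi> (v j) else 0)"
        by (intro sum.cong) (auto simp: less)
      finally show ?case by (intro zero) simp
    qed
    moreover have "\<psi> e0 = 0" by (intro zero) (simp add: Ue0)
    ultimately have 0: "\<psi> y = 0" if "y \<in> insert e0 (range v)" for y using that by blast
    have "\<psi> y = 0" for y by (rule bounded_clinear_eq_on_dense_span[OF \<psi>(1) dense 0])
    then have "\<psi> = (\<lambda>x. 0)" by (rule ext)
    then show False using \<psi>(2) by blast
  qed
qed

lemma U_poly_comb: "U (poly_comb v p) = poly_comb v (shift_poly 1 p)"
proof -
  have mono: "U (poly_comb v (monom c j)) = poly_comb v (shift_poly 1 (monom c j))" for c j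
  proof -
    have "shift_poly 1 (monom c j) = smult c ([:1, 1:] ^ j)"
      by (simp add: shift_poly_def monom_altdef pcompose_smult pcompose_power pcompose_pCons)
    moreover have "poly_comb v ([:1, 1:] ^ j) = (\<Sum>i\<le>j. of_nat (j choose i) *\<^sub>C v i)"
      using degree_power_le[of "[:1, 1:] :: complex poly" j]
      by (subst poly_comb_eq_sum[of _ j]) (auto simp: coeff_linear_poly_power)
    ultimately show ?thesis
      by (simp add: poly_comb_monom poly_comb_smult bounded_clinear_scaleC[OF U] Uv)
  qed
  have "U (poly_comb v (\<Sum>i\<le>n. monom (coeff p i) i))
      = poly_comb v (shift_poly 1 (\<Sum>i\<le>n. monom (coeff p i) i))" for n
    by (simp add: shift_poly_def pcompose_sum poly_comb_sum bounded_clinear_sum[OF U]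
        mono[unfolded shift_poly_def])
  then show ?thesis using poly_as_sum_of_monoms[of p] by metis
qed

lemma funpow_U_poly_comb: "(U ^^ n) (poly_comb v p) = poly_comb v (shift_poly (of_nat n) p)"
  by (induction n) (simp_all add: shift_poly_0 U_poly_comb shift_poly_shift_poly)

lemma poly_comb_conv:
  assumes "conv_poly P Q" "\<And>n. degree (P n) \<le> K" "degree Q \<le> K"
  shows "(\<lambda>n. poly_comb v (P n)) \<longlonglongrightarrow> poly_comb v Q"
  using assms by (intro poly_comb_tendsto[of _ K]) (auto simp: conv_poly_def)

text \<open>For \<open>v j\<close> the witness is the combination given by
  \<open>near_poly j n\<close>, built for the translation by \<open>Suc n\<close>; linearity extends
  this to the span.\<close>

lemma approx_start:
  assumes "u \<in> cspan (range v)"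
  obtains s where "s \<longlonglongrightarrow> u" "(\<lambda>n. (U ^^ Suc n) (s n)) \<longlonglongrightarrow> 0"
proof -
  have "\<exists>s. s \<longlonglongrightarrow> u \<and> (\<lambda>n. (U ^^ Suc n) (s n)) \<longlonglongrightarrow> 0"
    using assms
  proof (induction rule: complex_vector.span_induct_alt)
    case base
    have "(\<lambda>n. (U ^^ Suc n) 0) \<longlonglongrightarrow> 0"
      by (simp only: bounded_clinear_zero[OF bounded_clinear_funpow[OF U]] tendsto_const)
    then show ?case by (intro exI[of _ "\<lambda>n. 0"]) auto
  next
    case (step c y z)
    then obtain j where y: "y = v j" by blast
    obtain s where s: "s \<longlonglongrightarrow> z" "(\<lambda>n. (U ^^ Suc n) (s n)) \<longlonglongrightarrow> 0" using step by blast
    let ?t = "\<lambda>n. poly_comb v (near_poly j n)"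
    have 1: "?t \<longlonglongrightarrow> poly_comb v (monom 1 j)"
      by (rule poly_comb_conv[OF conv_near_poly degree_near_poly]) (simp add: degree_monom_eq)
    have "(\<lambda>n. poly_comb v (shift_poly (of_nat (Suc n)) (near_poly j n))) \<longlonglongrightarrow> poly_comb v 0"
      by (rule poly_comb_conv[OF conv_shift_near_poly, of _ "Suc (2 * j)"])
        (simp_all only: degree_shift_poly degree_near_poly degree_0 le0)
    then have 2: "(\<lambda>n. (U ^^ Suc n) (?t n)) \<longlonglongrightarrow> 0" by (simp only: funpow_U_poly_comb poly_comb_0)
    have "(\<lambda>n. c *\<^sub>C ?t n + s n) \<longlonglongrightarrow> c *\<^sub>C y + z"
      using 1 by (intro tendsto_add s scaleC.tendsto tendsto_const) (simp add: y poly_comb_monom)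
    moreover have "(\<lambda>n. c *\<^sub>C (U ^^ Suc n) (?t n) + (U ^^ Suc n) (s n)) \<longlonglongrightarrow> c *\<^sub>C 0 + 0"
      by (intro tendsto_add s scaleC.tendsto tendsto_const 2)
    then have "(\<lambda>n. (U ^^ Suc n) (c *\<^sub>C ?t n + s n)) \<longlonglongrightarrow> 0"
      by (simp only: bounded_clinear_simps[OF bounded_clinear_funpow[OF U]] scaleC.zero_right add_0)
    ultimately show ?case by blast
  qed
  then show thesis using that by blast
qed

text \<open>The counterpart of \<open>approx_start\<close>, with \<open>far_poly\<close> as
  witness.\<close>

lemma approx_end:
  assumes "u \<in> cspan (range v)"
  obtains s where "s \<longlonglongrightarrow> 0" "(\<lambda>n. (U ^^ Suc n) (s n)) \<longlonglongrightarrow> u"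
proof -
  have "\<exists>s. s \<longlonglongrightarrow> 0 \<and> (\<lambda>n. (U ^^ Suc n) (s n)) \<longlonglongrightarrow> u"
    using assms
  proof (induction rule: complex_vector.span_induct_alt)
    case base
    have "(\<lambda>n. (U ^^ Suc n) 0) \<longlonglongrightarrow> 0"
      by (simp only: bounded_clinear_zero[OF bounded_clinear_funpow[OF U]] tendsto_const)
    then show ?case by (intro exI[of _ "\<lambda>n. 0"]) auto
  next
    case (step c y z)
    then obtain j where y: "y = v j" by blast
    obtain s where s: "s \<longlonglongrightarrow> 0" "(\<lambda>n. (U ^^ Suc n) (s n)) \<longlonglongrightarrow> z" using step by blast
    let ?t = "\<lambda>n. poly_comb v (far_poly j n)"
    have "?t \<longlonglongrightarrow> poly_comb v 0"
      by (rule poly_comb_conv[OF conv_far_poly degree_far_poly]) simp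
    then have 1: "?t \<longlonglongrightarrow> 0" by (simp only: poly_comb_0)
    have "(\<lambda>n. poly_comb v (shift_poly (of_nat (Suc n)) (far_poly j n))) \<longlonglongrightarrow> poly_comb v (monom 1 j)"
      by (rule poly_comb_conv[OF conv_shift_far_poly, of _ "Suc (2 * j)"])
        (simp_all only: degree_shift_poly degree_far_poly, simp add: degree_monom_eq)
    then have 2: "(\<lambda>n. (U ^^ Suc n) (?t n)) \<longlonglongrightarrow> y"
      by (simp only: funpow_U_poly_comb poly_comb_monom y scaleC_one)
    have "(\<lambda>n. c *\<^sub>C ?t n + s n) \<longlonglongrightarrow> c *\<^sub>C 0 + 0"
      by (intro tendsto_add s scaleC.tendsto tendsto_const 1)
    then have "(\<lambda>n. c *\<^sub>C ?t n + s n) \<longlonglongrightarrow> 0" by (simp only: scaleC.zero_right add_0)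
    moreover have "(\<lambda>n. c *\<^sub>C (U ^^ Suc n) (?t n) + (U ^^ Suc n) (s n)) \<longlonglongrightarrow> c *\<^sub>C y + z"
      by (intro tendsto_add s scaleC.tendsto tendsto_const 2)
    then have "(\<lambda>n. (U ^^ Suc n) (c *\<^sub>C ?t n + s n)) \<longlonglongrightarrow> c *\<^sub>C y + z"
      by (simp only: bounded_clinear_simps[OF bounded_clinear_funpow[OF U]])
    ultimately show ?case by blast
  qed
  then show thesis using that by blast
qed

lemma funpow_U_e0: "(U ^^ n) e0 = e0"
  by (induction n) (simp_all add: Ue0)

text \<open>The coefficient of \<open>e0\<close> must be non-zero because \<open>U\<close> fixes
  \<open>e0\<close>: only a finite non-zero scalar can match two such coefficients.\<close>

definition good :: "'a set"
  where "good = {a *\<^sub>C e0 + u | a u. a \<noteq> 0 \<and> u \<in> cspan (range v)}"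

lemma closure_good: "closure good = UNIV"
proof -
  have "y \<in> closure good" if y: "y \<in> cspan (insert e0 (range v))" for y
  proof -
    obtain a where a: "y - a *\<^sub>C e0 \<in> cspan (range v)"
      using y unfolding complex_vector.span_breakdown_eq by blast
    define b where "b n = (if a = 0 then 1 / of_nat (Suc n) else a)" for n
    have "b \<longlonglongrightarrow> a" unfolding b_def[abs_def] using inverse_of_nat_Suc_tendsto by (cases "a = 0") auto
    then have "(\<lambda>n. b n *\<^sub>C e0 + (y - a *\<^sub>C e0)) \<longlonglongrightarrow> a *\<^sub>C e0 + (y - a *\<^sub>C e0)"
      by (intro tendsto_add scaleC.tendsto tendsto_const)
    then have "(\<lambda>n. b n *\<^sub>C e0 + (y - a *\<^sub>C e0)) \<longlonglongrightarrow> y" by simp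
    moreover have "b n \<noteq> 0" for n by (simp add: b_def del: of_nat_Suc)
    then have "b n *\<^sub>C e0 + (y - a *\<^sub>C e0) \<in> good" for n using a unfolding good_def by blast
    ultimately show ?thesis
      unfolding closure_sequential by (intro exI[of _ "\<lambda>n. b n *\<^sub>C e0 + (y - a *\<^sub>C e0)"]) simp
  qed
  then have "closure (cspan (insert e0 (range v))) \<subseteq> closure good" by (intro closure_minimal) auto
  then show ?thesis using dense by auto
qed

text \<open>For \<open>y = a e0 + u\<close> and \<open>z = b e0 + w\<close>, one perturbation makes
  \<open>u\<close> die out and another grows from 0 to \<open>(a / b) w\<close>. The scalar
  \<open>b / a\<close> then sends \<open>a e0 + (a / b) w\<close> to \<open>z\<close>.\<close>

lemma good_transitive:
  assumes "y \<in> good" "z \<in> good"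
  obtains c s where "s \<longlonglongrightarrow> y" "(\<lambda>n. c *\<^sub>C (U ^^ Suc n) (s n)) \<longlonglongrightarrow> z"
proof -
  obtain a u where a: "y = a *\<^sub>C e0 + u" "a \<noteq> 0" "u \<in> cspan (range v)"
    using assms(1) by (auto simp: good_def)
  obtain b w where b: "z = b *\<^sub>C e0 + w" "b \<noteq> 0" "w \<in> cspan (range v)"
    using assms(2) by (auto simp: good_def)
  obtain s where s: "s \<longlonglongrightarrow> u" "(\<lambda>n. (U ^^ Suc n) (s n)) \<longlonglongrightarrow> 0"
    using approx_start[OF a(3)] by blast
  obtain t where t: "t \<longlonglongrightarrow> 0" "(\<lambda>n. (U ^^ Suc n) (t n)) \<longlonglongrightarrow> (a / b) *\<^sub>C w"
    using approx_end[OF complex_vector.span_scale[OF b(3), of "a / b"]] by blast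
  let ?s = "\<lambda>n. a *\<^sub>C e0 + s n + t n"
  have "?s \<longlonglongrightarrow> a *\<^sub>C e0 + u + 0" by (intro tendsto_add tendsto_const s t)
  then have 1: "?s \<longlonglongrightarrow> y" by (simp add: a)
  have eq: "(b / a) *\<^sub>C (U ^^ Suc n) (?s n)
      = b *\<^sub>C e0 + (b / a) *\<^sub>C (U ^^ Suc n) (s n) + (b / a) *\<^sub>C (U ^^ Suc n) (t n)" for n
    using a(2) by (simp only: bounded_clinear_simps[OF bounded_clinear_funpow[OF U]] funpow_U_e0
        scaleC_add_right scaleC_scaleC) simp
  have "(\<lambda>n. (b / a) *\<^sub>C (U ^^ Suc n) (?s n))
      \<longlonglongrightarrow> b *\<^sub>C e0 + (b / a) *\<^sub>C 0 + (b / a) *\<^sub>C ((a / b) *\<^sub>C w)"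
    unfolding eq by (intro tendsto_add tendsto_const scaleC.tendsto s t)
  also have "b *\<^sub>C e0 + (b / a) *\<^sub>C 0 + (b / a) *\<^sub>C ((a / b) *\<^sub>C w) = z"
    using a(2) b(2) by (simp add: b scaleC_scaleC scaleC.zero_right)
  finally show thesis using 1 that by blast
qed

text \<open>Birkhoff's transitivity argument: the vectors whose scaled orbit meets a given ball form
  an open set, dense by \<open>good_transitive\<close>. A point in all these sets for a countable
  family of balls exists by Baire.\<close>

theorem supercyclic:
  assumes "separable_space (euclidean :: 'a topology)"
  shows "supercyclic_op UNIV U"
proof -
  obtain d :: "nat \<Rightarrow> 'a" where d: "closure (range d) = UNIV"
    using separable_dense_sequence[OF assms] by blast
  define W where "W k m = ball (d k) (1 / real (Suc m))" for k m
  define O' where "O' k m = (\<Union>n c. (\<lambda>y. c *\<^sub>C (U ^^ n) y) -` W k m)" for k m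
  have op: "open (O' k m)" for k m
    unfolding O'_def
    by (intro open_UN ballI open_vimage)
      (auto simp: W_def intro!: scaleC.continuous_on continuous_on_const continuous_on_id
        bounded_clinear_continuous_on[OF bounded_clinear_funpow[OF U]])
  have cl: "closure (O' k m) = UNIV" for k m
  proof -
    have oW: "open (W k m)" by (simp add: W_def)
    have "d k \<in> W k m" by (simp add: W_def)
    then have "W k m \<inter> closure good \<noteq> {}" using closure_good by auto
    then obtain z where z: "z \<in> W k m" "z \<in> good" using open_Int_closure_eq_empty[OF oW] by blast
    have "y \<in> closure (O' k m)" if y: "y \<in> good" for y
    proof -
      obtain c s where s: "s \<longlonglongrightarrow> y" "(\<lambda>n. c *\<^sub>C (U ^^ Suc n) (s n)) \<longlonglongrightarrow> z"
        using good_transitive[OF y z(2)] by blast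
      have "\<forall>\<^sub>F n in sequentially. c *\<^sub>C (U ^^ Suc n) (s n) \<in> W k m"
        using topological_tendstoD[OF s(2) oW z(1)] .
      then have "\<forall>\<^sub>F n in sequentially. s n \<in> closure (O' k m)"
      proof eventually_elim
        case (elim n)
        then have "s n \<in> O' k m" unfolding O'_def by blast
        then show ?case by (rule subsetD[OF closure_subset])
      qed
      then show ?thesis using s(1) by (intro Lim_in_closed_set[OF closed_closure]) auto
    qed
    then have "closure good \<subseteq> closure (O' k m)" by (intro closure_minimal) auto
    then show ?thesis using closure_good by auto
  qed
  have "euclidean closure_of (\<Inter>((\<lambda>(k, m). O' k m) ` UNIV)) = topspace (euclidean :: 'a topology)"
  proof (rule Baire_category)
    show "completely_metrizable_space (euclidean :: 'a topology) \<or>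
        locally_compact_space (euclidean :: 'a topology) \<and> regular_space (euclidean :: 'a topology)"
      using completely_metrizable_space_euclidean by blast
    show "countable ((\<lambda>(k, m). O' k m) ` (UNIV :: (nat \<times> nat) set))" by simp
    show "openin euclidean T \<and> euclidean closure_of T = topspace euclidean"
      if "T \<in> (\<lambda>(k, m). O' k m) ` UNIV" for T
      using that op cl by auto
  qed
  then have "closure (\<Inter>((\<lambda>(k, m). O' k m) ` UNIV)) = UNIV" by simp
  then have "\<Inter>((\<lambda>(k, m). O' k m) ` UNIV) \<noteq> {}" by (metis UNIV_not_empty closure_empty)
  then obtain x where x: "\<And>k m. x \<in> O' k m" by auto
  have "y \<in> closure (scaled_orbit UNIV x U)" for y
    unfolding closure_approachable
  proof (intro allI impI)
    fix e :: real assume e: "e > 0"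
    obtain k where k: "dist (d k) y < e/2"
      using d e closure_approachable[of y "range d"] by (metis UNIV_I half_gt_zero rangeE)
    obtain m where m: "1 / real (Suc m) < e/2"
      using reals_Archimedean[of "e/2"] e by (auto simp: inverse_eq_divide)
    obtain n c where "c *\<^sub>C (U ^^ n) x \<in> W k m" using x[of k m] by (auto simp: O'_def)
    then have "dist (d k) (c *\<^sub>C (U ^^ n) x) < e/2" using m by (simp add: W_def)
    then have "dist (c *\<^sub>C (U ^^ n) x) y < e"
      using k dist_triangle[of "c *\<^sub>C (U ^^ n) x" y "d k"] by (simp add: dist_commute)
    moreover have "c *\<^sub>C (U ^^ n) x \<in> scaled_orbit UNIV x U" unfolding scaled_orbit_def by blast
    ultimately show "\<exists>w\<in>scaled_orbit UNIV x U. dist w y < e" by blast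
  qed
  then show ?thesis by (auto simp: supercyclic_op_def supercyclic_vector_def)
qed

end

text \<open>\<open>U\<close> is the identity plus a series of rank-one operators
  \<open>y \<mapsto> g j y *\<^sub>C d j\<close>. The vector \<open>e 0\<close> is reserved as the
  fixed vector, which explains the index \<open>Suc j\<close> elsewhere.\<close>

lemma translation_operator_exists:
  assumes sep: "separable_space (euclidean :: 'a::complex_banach topology)"
    and inf: "\<nexists>B :: 'a::complex_banach set. finite B \<and> cspan B = UNIV"
  obtains U :: "'a \<Rightarrow> 'a::complex_banach" and \<phi> e0 v where "translation_operator U \<phi> e0 v"
proof -
  obtain e :: "nat \<Rightarrow> 'a" and f :: "nat \<Rightarrow> 'a \<Rightarrow> complex" where f: "\<And>n. bounded_clinear (f n)"
    and fe: "\<And>m n. f m (e n) = (if m = n then 1 else 0)" and e: "closure (cspan (range e)) = UNIV"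
  proof (rule biorthogonal_sequence[OF sep inf])
    fix e' :: "nat \<Rightarrow> 'a" and f' :: "nat \<Rightarrow> 'a \<Rightarrow> complex"
    assume "\<And>n. bounded_clinear (f' n)" "\<And>m n. f' m (e' n) = (if m = n then 1 else 0)"
      "closure (cspan (range e')) = UNIV"
    then show thesis by (intro that[of f' e'])
  qed
  have "\<exists>K>0. \<forall>y. norm (f (Suc j) y) \<le> norm y * K" for j
    by (rule bounded_linear.pos_bounded[OF bounded_clinear_imp_bounded_linear[OF f]])
  then obtain K where K: "\<And>j. K j > 0" "\<And>j y. norm (f (Suc j) y) \<le> norm y * K j" by metis
  \<comment> \<open>Dividing \<open>f (Suc j)\<close> by \<open>a j\<close> cancels both its norm
    bound \<open>K j\<close> and the size of \<open>d j\<close>, and the factor \<open>2 ^ j\<close>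
    leaves a geometric series.\<close>
  define a where "a = weight (\<lambda>j. 2 ^ j * K j) (\<lambda>i. norm (e (Suc i)))"
  have a1: "a j \<ge> 1" for j
    unfolding a_def by (rule weight_ge_1) (auto intro!: mult_nonneg_nonneg less_imp_le[OF K(1)])
  have a0: "a j > 0" for j using a1[of j] by linarith
  define v where "v j = complex_of_real (a j) *\<^sub>C e (Suc j)" for j
  define g where "g j y = (1 / complex_of_real (a j)) * f (Suc j) y" for j y
  \<comment> \<open>This is the part of the binomial expansion of \<open>U (v j)\<close> below the
    diagonal term \<open>v j\<close>.\<close>
  define d where "d j = (\<Sum>i<j. of_nat (j choose i) *\<^sub>C v i)" for j
  have g: "bounded_clinear (g j)" for j
    unfolding g_def[abs_def] by (rule bounded_clinear_mult_const[OF f])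
  have gv: "g j (v i) = (if i = j then 1 else 0)" for i j
    using a0[of j] by (simp add: g_def v_def bounded_clinear_times[OF f] fe)
  have f0v: "f 0 (v i) = 0" for i by (simp add: v_def bounded_clinear_times[OF f] fe)
  have bound: "norm (g j y) * norm (d j) \<le> (1/2) ^ j * norm y" for j y
  proof -
    define S where "S = (\<Sum>i<j. real (j choose i) * (a i * norm (e (Suc i))))"
    have "norm (d j) \<le> (\<Sum>i<j. norm (of_nat (j choose i) *\<^sub>C v i))"
      unfolding d_def by (rule norm_sum)
    also have "\<dots> = S"
      unfolding S_def by (intro sum.cong refl) (simp add: norm_scaleC v_def norm_mult abs_of_pos[OF a0])
    finally have dS: "norm (d j) \<le> S" .
    have aj: "2 ^ j * K j * S \<le> a j"
      unfolding a_def S_def by (subst (2) weight.simps) simp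
    have "norm (g j y) \<le> norm y * K j / a j"
      using K(2)[of j y] a0[of j] by (simp add: g_def norm_mult norm_divide divide_right_mono)
    then have "norm (g j y) * norm (d j) \<le> (norm y * K j / a j) * S"
      using dS K(1)[of j] a0[of j] by (intro mult_mono) (auto simp: less_imp_le)
    also have "\<dots> = norm y / 2 ^ j * ((2 ^ j * K j * S) / a j)" by (simp add: field_simps)
    also have "\<dots> \<le> norm y / 2 ^ j * 1"
      using aj a0[of j] by (intro mult_left_mono) (auto simp: field_simps)
    finally show ?thesis by (simp add: power_divide)
  qed
  note series = bounded_clinear_rank_one_series[OF g bound]
  define U where "U y = y + (\<Sum>j. g j y *\<^sub>C d j)" for y
  show thesis
  proof (rule that[of U "f 0" "e 0" v], unfold_locales)
    show "bounded_clinear U"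
      unfolding U_def[abs_def] by (intro bounded_clinear_add_fun bounded_clinear_ident series)
    show "bounded_clinear (f 0)" by (rule f)
    show "f 0 (e 0) = 1" by (simp add: fe)
    have "f 0 (d j) = 0" for j
      by (simp add: d_def bounded_clinear_sum[OF f] bounded_clinear_times[OF f] f0v)
    then have "f 0 (\<Sum>j. g j y *\<^sub>C d j) = 0" for y
      using bounded_linear.suminf[OF bounded_clinear_imp_bounded_linear[OF f] series(1), of 0 y]
      by (simp add: bounded_clinear_times[OF f])
    then show "f 0 (U y) = f 0 y" for y by (simp add: U_def bounded_clinear_add[OF f])
    have "g j (e 0) = 0" for j by (simp add: g_def fe)
    then show "U (e 0) = e 0" by (simp add: U_def scaleC.zero_left)
    show "U (v j) = (\<Sum>i\<le>j. of_nat (j choose i) *\<^sub>C v i)" for j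
    proof -
      have "(\<Sum>k. g k (v j) *\<^sub>C d k) = (\<Sum>k\<in>{j}. g k (v j) *\<^sub>C d k)"
        by (rule suminf_finite) (auto simp: gv scaleC.zero_left)
      then have "U (v j) = v j + d j" by (simp add: U_def gv)
      then show ?thesis by (simp add: d_def flip: lessThan_Suc_atMost)
    qed
    have "e n \<in> cspan (insert (e 0) (range v))" for n
    proof (cases n)
      case 0
      then show ?thesis by (simp add: complex_vector.span_base)
    next
      case (Suc j)
      have en: "e n = (1 / complex_of_real (a j)) *\<^sub>C v j"
        using a0[of j] by (simp add: v_def scaleC_scaleC Suc)
      show ?thesis unfolding en by (intro complex_vector.span_scale complex_vector.span_base) simp
    qed
    then have "cspan (range e) \<subseteq> cspan (insert (e 0) (range v))"
      by (intro complex_vector.span_minimal complex_vector.subspace_span) auto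
    then have "closure (cspan (range e)) \<subseteq> closure (cspan (insert (e 0) (range v)))"
      by (rule closure_mono)
    then show "closure (cspan (insert (e 0) (range v))) = UNIV" using e by auto
  qed
qed

text \<open>In infinite dimension the translation operator serves; in dimension one the identity
  does.\<close>

theorem supercyclic_fixing_functional_exists:
  assumes "separable_dim_one_or_infinite TYPE('a::complex_banach)"
  obtains U :: "'a \<Rightarrow> 'a::complex_banach" and \<phi> a where "bounded_clinear U" "bounded_clinear \<phi>"
    "\<And>y. \<phi> (U y) = \<phi> y" "\<phi> a = (1::complex)" "adjoint_point_spectrum U = {1}" "supercyclic_op UNIV U"
proof (cases "\<exists>B :: 'a set. finite B \<and> cspan B = UNIV")
  case False
  have sep: "separable_space (euclidean :: 'a topology)"
    using assms by (simp add: separable_dim_one_or_infinite_def)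
  obtain U :: "'a \<Rightarrow> 'a" and \<phi> e0 v where "translation_operator U \<phi> e0 v"
    using translation_operator_exists[OF sep False] by blast
  then interpret translation_operator U \<phi> e0 v .
  show thesis
    using that[OF U \<phi> \<phi>U \<phi>e0 adjoint_point_spectrum_eq supercyclic[OF sep]] .
next
  case True
  then have dim: "cdim (UNIV :: 'a set) = 1"
    using assms by (simp add: separable_dim_one_or_infinite_def)
  obtain B :: "'a set" where B: "complex_vector.independent B" "UNIV \<subseteq> cspan B" "card B = 1"
    using complex_vector.basis_exists[of "UNIV :: 'a set"] dim by metis
  then obtain b where b: "B = {b}" by (metis card_1_singletonE)
  then have "b \<noteq> 0" using B(1) complex_vector.dependent_zero by blast
  then obtain \<phi> where \<phi>: "\<phi> \<in> dual_space" "\<phi> b = 1" using Hahn_Banach_nonzero by blast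
  have span: "\<exists>k. y = k *\<^sub>C b" for y
  proof -
    have "y \<in> cspan (insert b {})" using B(2) b by auto
    then show ?thesis unfolding complex_vector.span_breakdown_eq by auto
  qed
  have b\<phi>: "bounded_clinear \<phi>" using \<phi>(1) by (simp add: dual_space_def)
  show thesis
  proof (rule that[of "\<lambda>y. y" \<phi> b])
    have "\<phi> \<noteq> (\<lambda>x. 0)" using \<phi>(2) by auto
    then have "1 \<in> adjoint_point_spectrum (\<lambda>y::'a. y)"
      using \<phi>(1) by (auto simp: adjoint_point_spectrum_def adjoint_op_def o_def)
    moreover have "\<mu> = 1" if "\<mu> \<in> adjoint_point_spectrum (\<lambda>y::'a. y)" for \<mu>
      using that by (auto simp: adjoint_point_spectrum_def adjoint_op_def o_def fun_eq_iff)
    ultimately show "adjoint_point_spectrum (\<lambda>y::'a. y) = {1}" by blast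
    have "scaled_orbit UNIV b (\<lambda>y. y) = UNIV"
    proof (intro equalityI subset_UNIV subsetI)
      fix y
      obtain k where k: "y = k *\<^sub>C b" using span by blast
      then have "y = k *\<^sub>C ((\<lambda>y. y) ^^ 0) b" by simp
      then show "y \<in> scaled_orbit UNIV b (\<lambda>y. y)" unfolding scaled_orbit_def by blast
    qed
    then have "supercyclic_vector UNIV (\<lambda>y. y) b" by (simp add: supercyclic_vector_def)
    then show "supercyclic_op UNIV (\<lambda>y::'a. y)" unfolding supercyclic_op_def by blast
  qed (use b\<phi> \<phi> bounded_clinear_ident in auto)
qed

subsection \<open>Scalar multiples and rotations\<close>

lemma adjoint_point_spectrum_scaleC:
  assumes U: "adjoint_point_spectrum U = {1}" and c: "c \<noteq> 0"
  shows "adjoint_point_spectrum (\<lambda>y. c *\<^sub>C U y) = {c}"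
proof -
  have "\<mu> \<in> adjoint_point_spectrum (\<lambda>y. c *\<^sub>C U y) \<longleftrightarrow> \<mu> / c \<in> adjoint_point_spectrum U" for \<mu>
  proof -
    have "adjoint_op (\<lambda>y. c *\<^sub>C U y) \<psi> = (\<lambda>x. \<mu> * \<psi> x) \<longleftrightarrow> adjoint_op U \<psi> = (\<lambda>x. \<mu> / c * \<psi> x)"
      if "\<psi> \<in> dual_space" for \<psi>
    proof -
      have \<psi>: "bounded_clinear \<psi>" using that by (simp add: dual_space_def)
      have "c * \<psi> (U x) = \<mu> * \<psi> x \<longleftrightarrow> \<psi> (U x) = \<mu> / c * \<psi> x" for x
        using c by (auto simp: field_simps)
      then show ?thesis
        by (simp add: adjoint_op_def fun_eq_iff bounded_clinear_times[OF \<psi>])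
    qed
    then show ?thesis unfolding adjoint_point_spectrum_def by blast
  qed
  moreover have "\<mu> / c = 1 \<longleftrightarrow> \<mu> = c" for \<mu> using c by auto
  ultimately show ?thesis using U by auto
qed

lemma supercyclic_vector_scaleC:
  assumes U: "bounded_clinear U" and c: "c \<noteq> 0" and x: "supercyclic_vector UNIV U x"
  shows "supercyclic_vector UNIV (\<lambda>y. c *\<^sub>C U y) x"
proof -
  have "a *\<^sub>C (U ^^ n) x = (a / c ^ n) *\<^sub>C ((\<lambda>y. c *\<^sub>C U y) ^^ n) x" for a n
    using c by (simp add: funpow_scaleC[OF U] scaleC_scaleC)
  then have "scaled_orbit UNIV x U \<subseteq> scaled_orbit UNIV x (\<lambda>y. c *\<^sub>C U y)"
    unfolding scaled_orbit_def by blast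
  then show ?thesis
    using x closure_mono[of "scaled_orbit UNIV x U"] unfolding supercyclic_vector_def by blast
qed

text \<open>The functional \<open>\<phi>\<close>, divided by \<open>\<phi> x\<close>, maps the
  scaled orbit to the scalars \<open>\<gamma> * \<mu> ^ n\<close>; being continuous and onto, it
  maps a dense set to a dense set.\<close>

lemma supercyclic_vector_imp_scalars_dense:
  assumes super: "supercyclic_vector \<Gamma> T x" and \<phi>: "bounded_clinear \<phi>"
    and eig: "\<And>y. \<phi> (T y) = \<mu> * \<phi> y" and a: "\<phi> a = (1::complex)"
  shows "closure {\<gamma> * \<mu> ^ n | \<gamma> n. \<gamma> \<in> \<Gamma>} = UNIV"
proof -
  have x: "\<phi> x \<noteq> 0"
    by (rule supercyclic_vector_functional_nonzero[OF super \<phi> eig, of a]) (simp add: a)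
  have n: "\<phi> ((T ^^ n) x) = \<mu> ^ n * \<phi> x" for n by (induction n) (auto simp: eig)
  have bl: "bounded_linear (\<lambda>y. (1 / \<phi> x) * \<phi> y)"
    by (intro bounded_clinear_imp_bounded_linear bounded_clinear_mult_const \<phi>)
  have "(1 / \<phi> x) * \<phi> (\<gamma> *\<^sub>C (T ^^ n) x) = \<gamma> * \<mu> ^ n" for \<gamma> n
    using x by (simp add: bounded_clinear_times[OF \<phi>] n)
  then have sub: "(\<lambda>y. (1 / \<phi> x) * \<phi> y) ` scaled_orbit \<Gamma> x T \<subseteq> {\<gamma> * \<mu> ^ n | \<gamma> n. \<gamma> \<in> \<Gamma>}"
    unfolding scaled_orbit_def by blast
  have "(\<lambda>y. (1 / \<phi> x) * \<phi> y) ` closure (scaled_orbit \<Gamma> x T)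
      \<subseteq> closure ((\<lambda>y. (1 / \<phi> x) * \<phi> y) ` scaled_orbit \<Gamma> x T)"
    by (rule closure_bounded_linear_image_subset[OF bl])
  also have "\<dots> \<subseteq> closure {\<gamma> * \<mu> ^ n | \<gamma> n. \<gamma> \<in> \<Gamma>}" by (rule closure_mono[OF sub])
  finally have "range (\<lambda>y. (1 / \<phi> x) * \<phi> y) \<subseteq> closure {\<gamma> * \<mu> ^ n | \<gamma> n. \<gamma> \<in> \<Gamma>}"
    using super by (simp add: supercyclic_vector_def)
  moreover have "z \<in> range (\<lambda>y. (1 / \<phi> x) * \<phi> y)" for z
    using x by (intro image_eqI[of _ _ "(z * \<phi> x) *\<^sub>C a"]) (auto simp: bounded_clinear_times[OF \<phi>] a)
  ultimately show ?thesis by blast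
qed

text \<open>
  The scalars excluded from the witness lie in small disks around the points \<open>\<lambda> ^ - n\<close>, whose moduli
  are separated because \<open>r \<noteq> 1\<close>; rotating such a scalar by \<open>cis \<theta>\<close> leaves these disks.
\<close>

lemma rotations_dense_but_not_powers:
  assumes r: "r > 0" "r \<noteq> 1" and \<theta>: "cis \<theta> \<noteq> 1"
  obtains \<Gamma> where "closure (times_rotations \<Gamma> \<theta>) = UNIV"
    "closure {\<gamma> * rcis r \<theta> ^ n | \<gamma> n. \<gamma> \<in> \<Gamma>} \<noteq> UNIV"
proof -
  define l where "l = rcis r \<theta>"
  have nl: "norm (l ^ n) = r ^ n" for n using r by (simp add: l_def norm_power)
  define \<rho> where "\<rho> = max r (1 / r)"
  have \<rho>: "\<rho> > 1" using r by (cases "r > 1") (auto simp: \<rho>_def less_max_iff_disj less_divide_eq)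
  \<comment> \<open>The second bound means \<open>1 + e \<le> \<rho> * (1 - e)\<close>, so moduli
    differing by a factor of at least \<open>\<rho>\<close> cannot both be within \<open>e\<close>
    of 1. The first handles equal exponents.\<close>
  define e where "e = min (norm (cis \<theta> - 1) / 2) ((\<rho> - 1) / (\<rho> + 1))"
  have "e > 0" "2 * e \<le> norm (cis \<theta> - 1)" "e \<le> (\<rho> - 1) / (\<rho> + 1)"
    using \<rho> \<theta> by (auto simp: e_def)
  then have e: "e > 0" "2 * e \<le> norm (cis \<theta> - 1)" "e * (\<rho> + 1) \<le> \<rho> - 1"
    using \<rho> by (simp_all add: pos_le_divide_eq)
  define \<Gamma> where "\<Gamma> = {z. \<forall>n. norm (z * l ^ n - 1) \<ge> e}"
  have rpow: "\<rho> * r ^ m \<le> r ^ n \<or> \<rho> * r ^ n \<le> r ^ m" if "m < n" for m n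
  proof (cases "r > 1")
    case True
    then have "r * r ^ m \<le> r ^ n" using that power_increasing[of "Suc m" n r] by simp
    moreover have "1 / r < 1" using True by simp
    then have "1 / r \<le> r" using True by linarith
    then have "\<rho> = r" unfolding \<rho>_def by (rule max_absorb1)
    ultimately show ?thesis by simp
  next
    case False
    then have "r < 1" using r by simp
    then have rn: "r ^ n \<le> r * r ^ m" using that power_decreasing[of "Suc m" n r] r by simp
    have "1 < 1 / r" using \<open>r < 1\<close> r by simp
    then have "r \<le> 1 / r" using \<open>r < 1\<close> by linarith
    then have \<rho>r: "\<rho> = 1 / r" unfolding \<rho>_def by (rule max_absorb2)
    have "\<rho> * r ^ n \<le> 1 / r * (r * r ^ m)" unfolding \<rho>r by (intro mult_left_mono rn) (use r in simp)
    also have "\<dots> = r ^ m" using r by simp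
    finally show ?thesis ..
  qed
  have gap: "\<not> (\<rho> * s \<le> t \<and> 1 - e < s \<and> t < 1 + e)" for s t
  proof
    assume st: "\<rho> * s \<le> t \<and> 1 - e < s \<and> t < 1 + e"
    then have "\<rho> * (1 - e) < \<rho> * s" using \<rho> by simp
    then have "\<rho> * (1 - e) < 1 + e" using st by linarith
    then show False using e(3) by (simp add: algebra_simps)
  qed
  \<comment> \<open>If both failed, the moduli would force equal exponents. Then \<open>w\<close>
    and \<open>cis \<theta> * w\<close> would both be within \<open>e\<close> of 1, giving
    \<open>norm (cis \<theta> - 1) < 2 * e\<close>.\<close>
  have rot: "z \<in> \<Gamma> \<or> z * cis \<theta> \<in> \<Gamma>" for z
  proof (rule ccontr)
    assume "\<not> (z \<in> \<Gamma> \<or> z * cis \<theta> \<in> \<Gamma>)"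
    then obtain m n where m: "norm (z * l ^ m - 1) < e" and n: "norm (z * cis \<theta> * l ^ n - 1) < e"
      by (auto simp: \<Gamma>_def not_le)
    have "norm (z * l ^ m) = norm z * r ^ m" "norm (z * cis \<theta> * l ^ n) = norm z * r ^ n"
      by (simp_all add: norm_mult nl)
    then have bm: "1 - e < norm z * r ^ m" "norm z * r ^ m < 1 + e"
      and bn: "1 - e < norm z * r ^ n" "norm z * r ^ n < 1 + e"
      using m n norm_triangle_ineq3[of "z * l ^ m" 1] norm_triangle_ineq3[of "z * cis \<theta> * l ^ n" 1]
      by (auto simp: abs_le_iff)
    have scaled: "\<rho> * (norm z * r ^ i) \<le> norm z * r ^ j" if "\<rho> * r ^ i \<le> r ^ j" for i j
      using mult_left_mono[OF that, of "norm z"] by (simp add: mult.left_commute)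
    have "m = n"
    proof (cases m n rule: linorder_cases)
      case less
      then show ?thesis using rpow[OF less] scaled gap bm bn by blast
    next
      case greater
      then show ?thesis using rpow[OF greater] scaled gap bm bn by blast
    qed
    define w where "w = z * l ^ m"
    have w: "norm (w - 1) < e" "norm (cis \<theta> * w - 1) < e"
      using m n \<open>m = n\<close> by (simp_all add: w_def ac_simps)
    have "norm (cis \<theta> - 1) = norm (cis \<theta> * (1 - w) + (cis \<theta> * w - 1))" by (simp add: algebra_simps)
    also have "\<dots> \<le> norm (cis \<theta> * (1 - w)) + norm (cis \<theta> * w - 1)" by (rule norm_triangle_ineq)
    also have "norm (cis \<theta> * (1 - w)) = norm (w - 1)" by (simp add: norm_mult norm_minus_commute)
    finally show False using w e(2) by linarith
  qed
  have "times_rotations \<Gamma> \<theta> = UNIV"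
  proof (intro equalityI subset_UNIV subsetI)
    fix z
    show "z \<in> times_rotations \<Gamma> \<theta>"
    proof (cases "z \<in> \<Gamma>")
      case True
      have "z = z * cis (of_int 0 * \<theta>)" by simp
      then show ?thesis using True unfolding times_rotations_def rotation_group_def by blast
    next
      case False
      then have "z * cis \<theta> \<in> \<Gamma>" using rot by blast
      moreover have "z = (z * cis \<theta>) * cis (of_int (-1) * \<theta>)" by (simp add: cis_mult mult.assoc)
      ultimately show ?thesis unfolding times_rotations_def rotation_group_def by blast
    qed
  qed
  moreover have "1 \<notin> closure {\<gamma> * rcis r \<theta> ^ n | \<gamma> n. \<gamma> \<in> \<Gamma>}"
  proof
    assume "1 \<in> closure {\<gamma> * rcis r \<theta> ^ n | \<gamma> n. \<gamma> \<in> \<Gamma>}"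
    then obtain w where w: "w \<in> {\<gamma> * rcis r \<theta> ^ n | \<gamma> n. \<gamma> \<in> \<Gamma>}" "dist w 1 < e"
      using e(1) unfolding closure_approachable by blast
    then show False by (auto simp: \<Gamma>_def dist_norm not_le[symmetric] l_def)
  qed
  ultimately show thesis by (intro that[of \<Gamma>]) (simp_all only: closure_UNIV, blast)
qed

theorem theoremC:
  shows "(\<forall>\<theta> \<Gamma>. \<Gamma> \<noteq> {} \<and> closure (times_rotations \<Gamma> \<theta>) = UNIV \<longrightarrow>
           supercyclicity_coincides TYPE('a::complex_banach) \<theta> \<Gamma>) \<and>
         (separable_dim_one_or_infinite TYPE('a) \<longrightarrow>
           (\<forall>\<theta> \<Gamma>. \<Gamma> \<noteq> {} \<longrightarrow>
             (supercyclicity_coincides TYPE('a) \<theta> \<Gamma> \<longleftrightarrow>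
              closure (times_rotations \<Gamma> \<theta>) = UNIV)) \<and>
           (\<forall>r \<theta>. r > 0 \<and> r \<noteq> 1 \<and> cis \<theta> \<noteq> 1 \<longrightarrow>
             (\<exists>(T :: 'a \<Rightarrow> 'a) \<Gamma>. bounded_clinear T \<and>
               adjoint_point_spectrum T = {rcis r \<theta>} \<and>
               closure (times_rotations \<Gamma> \<theta>) = UNIV \<and>
               supercyclic_op UNIV T \<and> \<not> supercyclic_op \<Gamma> T)))"
proof -
  have suff: "supercyclicity_coincides TYPE('a) \<theta> \<Gamma>"
    if "closure (times_rotations \<Gamma> \<theta>) = UNIV" for \<theta> \<Gamma>
    unfolding supercyclicity_coincides_def
    using supercyclic_vector_of_dense_times_rotations[OF that] supercyclic_vector_mono by blast
  \<comment> \<open>One operator for each \<open>\<mu> \<noteq> 0\<close> serves both negative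
    statements, with \<open>\<mu> = cis \<theta>\<close> for necessity and
    \<open>\<mu> = rcis r \<theta>\<close> for the counterexample.\<close>
  have operator: "\<exists>(T :: 'a \<Rightarrow> 'a) x. bounded_clinear T \<and> adjoint_point_spectrum T = {\<mu>} \<and>
      supercyclic_vector UNIV T x \<and>
      (\<forall>\<Gamma> y. supercyclic_vector \<Gamma> T y \<longrightarrow> closure {\<gamma> * \<mu> ^ n | \<gamma> n. \<gamma> \<in> \<Gamma>} = UNIV)"
    if sep: "separable_dim_one_or_infinite TYPE('a)" and \<mu>: "\<mu> \<noteq> 0" for \<mu>
  proof -
    obtain U :: "'a \<Rightarrow> 'a" and \<phi> a where U: "bounded_clinear U" and \<phi>: "bounded_clinear \<phi>"
      and \<phi>U: "\<And>y. \<phi> (U y) = \<phi> y" and a: "\<phi> a = (1::complex)"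
      and spec: "adjoint_point_spectrum U = {1}" and super: "supercyclic_op UNIV U"
      using supercyclic_fixing_functional_exists[OF sep] by blast
    obtain x where x: "supercyclic_vector UNIV U x" using super by (auto simp: supercyclic_op_def)
    have eig: "\<phi> (\<mu> *\<^sub>C U y) = \<mu> * \<phi> y" for y by (simp add: bounded_clinear_times[OF \<phi>] \<phi>U)
    show ?thesis
      using bounded_clinear_scaleC_fun[OF U, of \<mu>] adjoint_point_spectrum_scaleC[OF spec \<mu>]
        supercyclic_vector_scaleC[OF U \<mu> x]
        supercyclic_vector_imp_scalars_dense[OF _ \<phi> eig a]
      by blast
  qed
  have nec: "closure (times_rotations \<Gamma> \<theta>) = UNIV"
    if sep: "separable_dim_one_or_infinite TYPE('a)"
      and co: "supercyclicity_coincides TYPE('a) \<theta> \<Gamma>" for \<theta> \<Gamma>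
  proof -
    obtain T :: "'a \<Rightarrow> 'a" and x where T: "bounded_clinear T" "adjoint_point_spectrum T = {cis \<theta>}"
      "supercyclic_vector UNIV T x"
      "\<And>\<Gamma> y. supercyclic_vector \<Gamma> T y \<Longrightarrow> closure {\<gamma> * cis \<theta> ^ n | \<gamma> n. \<gamma> \<in> \<Gamma>} = UNIV"
      using operator[OF sep cis_neq_zero[of \<theta>]] by blast
    have "supercyclic_vector \<Gamma> T x" using co T(1-3) unfolding supercyclicity_coincides_def by blast
    then have "closure {\<gamma> * cis \<theta> ^ n | \<gamma> n. \<gamma> \<in> \<Gamma>} = UNIV" by (rule T(4))
    moreover have "cis \<theta> ^ n = cis (of_int (int n) * \<theta>)" for n by (simp add: Complex.DeMoivre)
    then have "{\<gamma> * cis \<theta> ^ n | \<gamma> n. \<gamma> \<in> \<Gamma>} \<subseteq> times_rotations \<Gamma> \<theta>"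
      unfolding times_rotations_def rotation_group_def by blast
    ultimately show ?thesis using closure_mono by blast
  qed
  have part2: "\<exists>(T :: 'a \<Rightarrow> 'a) \<Gamma>. bounded_clinear T \<and> adjoint_point_spectrum T = {rcis r \<theta>} \<and>
      closure (times_rotations \<Gamma> \<theta>) = UNIV \<and> supercyclic_op UNIV T \<and> \<not> supercyclic_op \<Gamma> T"
    if sep: "separable_dim_one_or_infinite TYPE('a)" and r: "r > 0" "r \<noteq> 1" and \<theta>: "cis \<theta> \<noteq> 1"
    for r \<theta>
  proof -
    obtain \<Gamma> where \<Gamma>: "closure (times_rotations \<Gamma> \<theta>) = UNIV"
      "closure {\<gamma> * rcis r \<theta> ^ n | \<gamma> n. \<gamma> \<in> \<Gamma>} \<noteq> UNIV"
      using rotations_dense_but_not_powers[OF r \<theta>] by blast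
    have "rcis r \<theta> \<noteq> 0" using r by simp
    then show ?thesis
      using operator[OF sep, of "rcis r \<theta>"] \<Gamma> unfolding supercyclic_op_def by blast
  qed
  show ?thesis using suff nec part2 by blast
qed

end
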